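(* Let the operators $A$, $\Sigma_0$, the truth $u^\dagger$ and the initial mean $m_0$ satisfy Assumption A (in the context), and let $m_n$ be the Kalman filter mean computed from Data Model 2 with initial covariance $C_0=\frac{\gamma^2}{\alpha}\Sigma_0$. Then there is a constant $C$, independent of $n$, $\gamma$ and $\alpha$, such that for all $n\ge 1$ $$\mathbb{E}\|m_n-u^\dagger\|^2\le C\left(\frac{\alpha}{n}\right)^{\frac{s}{a+1}}+\frac{n\gamma^2}{\alpha}\,\mathrm{tr}(\Sigma_0).$$ Moreover, for every integer $N\ge 1$, if $\alpha=1$, the noise variance is $\gamma^2=N^{-\frac{a+s+1}{a+1}}$ and the iteration is stopped at $n=N$, then $$\mathbb{E}\|m_N-u^\dagger\|^2\le\left(C+\mathrm{tr}(\Sigma_0)\right)N^{-\frac{s}{a+1}}.$$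
   Context: $X,Y$ are Hilbert spaces, $A$ is a compact linear operator from $X$ to $Y$, $u^\dagger\in X$ is a fixed (deterministic) element, $\gamma>0$, $\alpha>0$. $\|\cdot\|$ denotes the norm of $X$ (also of $Y$ and operator norms), $\mathcal{R}$ and $\mathcal{D}$ denote range and domain. $\mathcal{N}(0,\gamma^2 I)$ is the centred Gaussian on $Y$ with covariance $\gamma^2 I$ (Gaussian white noise if $Y$ is infinite dimensional, so that $\mathbb{E}\|F\eta\|^2=\gamma^2\,\mathrm{tr}(FF^* )$ for $\eta\sim\mathcal{N}(0,\gamma^2I)$ and a bounded linear $F:Y\to X$). Data Model 2: $y_n=y$ for all $n\ge1$, where $y=Au^\dagger+\eta$ with a single draw $\eta\sim\mathcal{N}(0,\gamma^2I)$; the expectation is over $\eta$. Kalman filter: given $m_0\in X$ and $C_0$, for $n\ge 1$ $$K_n=C_{n-1}A^*(AC_{n-1}A^*+\gamma^2I)^{-1},\quad m_n=m_{n-1}+K_n(y_n-Am_{n-1}),\quad C_n=(I-K_nA)C_{n-1}.$$ Assumption A: (i) $C_0=\frac{\gamma^2}{\alpha}\Sigma_0$ and $\mathcal{R}(\Sigma_0^{1/2})\subset\mathcal{D}(A)$, where $\alpha>0$ is a constant, $\Sigma_0$ is positive self-adjoint on $X$, and $\Sigma_0^{-1}$ is a densely defined unbounded self-adjoint strictly positive operator; (ii) there are constants $a>0$ and $1\le c<\infty$ with $c^{-1}\|\Sigma_0^{a/2}x\|\le\|Ax\|\le c\|\Sigma_0^{a/2}x\|$ for all $x\in X$; (iii)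 $m_0-u^\dagger\in\mathcal{D}(\Sigma_0^{-s/2})$ with $0\le s\le a+2$; (iv) $\Sigma_0$ is trace class on $X$. *)

theory Defs
  imports "HOL-Probability.Probability"
begin

text \<open>Hilbert spaces are real and are given by types of class
  \<open>{real_inner, complete_space}\<close>; operators between them are plain functions.\<close>

definition compact_operator ::
  "('x::real_normed_vector \<Rightarrow> 'y::real_normed_vector) \<Rightarrow> bool" where
  "compact_operator A \<longleftrightarrow> linear A \<and> compact (closure (A ` cball 0 1))"

definition pos_selfadjoint :: "('x::real_inner \<Rightarrow> 'x) \<Rightarrow> bool" where
  "pos_selfadjoint S \<longleftrightarrow> bounded_linear S \<and> (\<forall>x y. S x \<bullet> y = x \<bullet> S y) \<and> (\<forall>x. 0 \<le> S x \<bullet> x)"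

text \<open>A possibly unbounded operator is a function \<open>L\<close> that matters only on its domain \<open>D\<close>.\<close>

definition densely_defined :: "'x::real_normed_vector set \<Rightarrow> ('x \<Rightarrow> 'x) \<Rightarrow> bool" where
  "densely_defined D L \<longleftrightarrow> subspace D \<and> closure D = UNIV \<and>
     (\<forall>x\<in>D. \<forall>y\<in>D. \<forall>r. L (r *\<^sub>R x + y) = r *\<^sub>R L x + L y)"

text \<open>Symmetry, together with the inclusion of the domain of the adjoint in \<open>D\<close>.\<close>

definition selfadjoint_on :: "'x::real_inner set \<Rightarrow> ('x \<Rightarrow> 'x) \<Rightarrow> bool" where
  "selfadjoint_on D L \<longleftrightarrow> (\<forall>x\<in>D. \<forall>y\<in>D. L x \<bullet> y = x \<bullet> L y) \<and>
     (\<forall>y z. (\<forall>x\<in>D. L x \<bullet> y = x \<bullet> z) \<longrightarrow> y \<in> D)"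

definition strictly_positive_on :: "'x::real_inner set \<Rightarrow> ('x \<Rightarrow> 'x) \<Rightarrow> bool" where
  "strictly_positive_on D L \<longleftrightarrow> (\<exists>\<kappa>>0. \<forall>x\<in>D. \<kappa> * (norm x)\<^sup>2 \<le> L x \<bullet> x)"

definition orthonormal_basis :: "'x::real_inner set \<Rightarrow> bool" where
  "orthonormal_basis E \<longleftrightarrow>
     pairwise orthogonal E \<and> (\<forall>e\<in>E. norm e = 1) \<and> closure (span E) = UNIV"

text \<open>Trace class and trace for positive operators only, where \<open>\<bar>S\<bar> = S\<close>; neither
  depends on the choice of the basis.\<close>

definition pos_trace_class :: "('x::real_inner \<Rightarrow> 'x) \<Rightarrow> bool" where
  "pos_trace_class S \<longleftrightarrow> (\<exists>E. orthonormal_basis E \<and> (\<lambda>e. S e \<bullet> e) summable_on E)"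

definition op_trace :: "('x::real_inner \<Rightarrow> 'x) \<Rightarrow> real" where
  "op_trace S = (\<Sum>\<^sub>\<infinity>e\<in>(SOME E. orthonormal_basis E). S e \<bullet> e)"

text \<open>Spectral calculus \<open>S\<^sup>p x = \<Sum> \<sigma>\<^sub>e\<^sup>p \<langle>x, e\<rangle> e\<close> over an orthonormal basis of eigenvectors, with
  \<open>\<sigma>\<^sub>e = \<langle>S e, e\<rangle>\<close> the eigenvalue at \<open>e\<close>. The basis exists for every compact (in particular every
  trace class) self-adjoint \<open>S\<close>, and the operator and its domain do not depend on which one is
  chosen. For \<open>p \<le> 0\<close> the definition is meant for injective \<open>S\<close>, as \<open>0 powr p = 0\<close>.\<close>

definition eigenbasis :: "('x::real_inner \<Rightarrow> 'x) \<Rightarrow> 'x set" where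
  "eigenbasis S = (SOME E. orthonormal_basis E \<and> (\<forall>e\<in>E. \<exists>\<sigma>. S e = \<sigma> *\<^sub>R e))"

definition op_powr :: "('x::real_inner \<Rightarrow> 'x) \<Rightarrow> real \<Rightarrow> 'x \<Rightarrow> 'x" where
  "op_powr S p x = (\<Sum>\<^sub>\<infinity>e\<in>eigenbasis S. ((S e \<bullet> e) powr p * (x \<bullet> e)) *\<^sub>R e)"

definition op_powr_dom :: "('x::real_inner \<Rightarrow> 'x) \<Rightarrow> real \<Rightarrow> 'x set" where
  "op_powr_dom S p = {x. (\<lambda>e. ((S e \<bullet> e) powr p * (x \<bullet> e))\<^sup>2) summable_on eigenbasis S}"

text \<open>The requirement \<open>\<R>(\<Sigma>\<^sub>0\<^sup>1\<^sup>/\<^sup>2) \<subseteq> \<D>(A)\<close> is void here, since \<open>A\<close> is defined on the whole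
  space. The inverse \<open>\<Sigma>\<^sub>0\<^sup>-\<^sup>1\<close> has domain \<open>range \<Sigma>\<^sub>0\<close>; it is unbounded unless the space is
  finite-dimensional, a case that is not excluded. The scaling
  \<open>C\<^sub>0 = (\<gamma>\<^sup>2 / \<alpha>) \<Sigma>\<^sub>0\<close> is imposed where the filter is run.\<close>

definition assumption_A ::
  "('x::real_inner \<Rightarrow> 'y::real_inner) \<Rightarrow> ('x \<Rightarrow> 'x) \<Rightarrow> 'x \<Rightarrow> 'x \<Rightarrow> real \<Rightarrow> real \<Rightarrow> real \<Rightarrow> bool" where
  "assumption_A A \<Sigma>\<^sub>0 u m\<^sub>0 a c s \<longleftrightarrow>
     pos_selfadjoint \<Sigma>\<^sub>0 \<and> inj \<Sigma>\<^sub>0 \<and>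
     densely_defined (range \<Sigma>\<^sub>0) (inv \<Sigma>\<^sub>0) \<and>
     selfadjoint_on (range \<Sigma>\<^sub>0) (inv \<Sigma>\<^sub>0) \<and>
     strictly_positive_on (range \<Sigma>\<^sub>0) (inv \<Sigma>\<^sub>0) \<and>
     0 < a \<and> 1 \<le> c \<and>
     (\<forall>x. inverse c * norm (op_powr \<Sigma>\<^sub>0 (a / 2) x) \<le> norm (A x) \<and>
          norm (A x) \<le> c * norm (op_powr \<Sigma>\<^sub>0 (a / 2) x)) \<and>
     0 \<le> s \<and> s \<le> a + 2 \<and> m\<^sub>0 - u \<in> op_powr_dom \<Sigma>\<^sub>0 (- s / 2) \<and>
     pos_trace_class \<Sigma>\<^sub>0"

text \<open>\<open>\<N>(0, \<gamma>\<^sup>2 I)\<close> as a generalised random element: \<open>\<eta> h\<close> plays the role of the pairing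
  \<open>\<langle>\<eta>, h\<rangle>\<close>, which is centred Gaussian with variance \<open>\<gamma>\<^sup>2 \<parallel>h\<parallel>\<^sup>2\<close> and almost surely linear in \<open>h\<close>.
  So all finite families \<open>\<eta> h\<^sub>1, \<dots>, \<eta> h\<^sub>k\<close> are jointly Gaussian with covariances
  \<open>\<gamma>\<^sup>2 \<langle>h\<^sub>i, h\<^sub>j\<rangle>\<close>. The random variable \<open>\<eta> 0\<close> vanishes almost surely by linearity.\<close>

definition white_noise ::
  "'w measure \<Rightarrow> real \<Rightarrow> ('y::real_inner \<Rightarrow> 'w \<Rightarrow> real) \<Rightarrow> bool" where
  "white_noise M \<gamma> \<eta> \<longleftrightarrow>
     (\<forall>h. \<eta> h \<in> borel_measurable M) \<and>
     (\<forall>r h k. AE w in M. \<eta> (r *\<^sub>R h + k) w = r * \<eta> h w + \<eta> k w) \<and>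
     (\<forall>h. h \<noteq> 0 \<longrightarrow> distributed M lborel (\<eta> h) (normal_density 0 (\<gamma> * norm h)))"

text \<open>\<open>Z\<close> is a version of \<open>F \<xi>\<close> for a generalised random element \<open>\<xi>\<close>:
  \<open>\<langle>Z, x\<rangle> = \<langle>\<xi>, F\<^sup>* x\<rangle>\<close> almost surely, for each \<open>x\<close>. For white noise such a \<open>Z\<close> exists if \<open>F\<close>
  is Hilbert-Schmidt (as every Kalman gain is, for trace class \<open>C\<^sub>0\<close>), and it is almost surely unique when the space is separable.\<close>

definition is_image_of ::
  "'w measure \<Rightarrow> ('y::real_inner \<Rightarrow> 'x::real_inner) \<Rightarrow> ('y \<Rightarrow> 'w \<Rightarrow> real) \<Rightarrow> ('w \<Rightarrow> 'x) \<Rightarrow> bool" where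
  "is_image_of M F \<xi> Z \<longleftrightarrow>
     Z \<in> borel_measurable M \<and> (\<forall>x. AE w in M. Z w \<bullet> x = \<xi> (adjoint F x) w)"

definition kalman_gain ::
  "('x::real_inner \<Rightarrow> 'y::real_inner) \<Rightarrow> real \<Rightarrow> ('x \<Rightarrow> 'x) \<Rightarrow> 'y \<Rightarrow> 'x" where
  "kalman_gain A \<gamma> C = C \<circ> adjoint A \<circ> inv (\<lambda>h. A (C (adjoint A h)) + \<gamma>\<^sup>2 *\<^sub>R h)"

fun kalman_cov ::
  "('x::real_inner \<Rightarrow> 'y::real_inner) \<Rightarrow> real \<Rightarrow> ('x \<Rightarrow> 'x) \<Rightarrow> nat \<Rightarrow> 'x \<Rightarrow> 'x" where
  "kalman_cov A \<gamma> C\<^sub>0 0 = C\<^sub>0"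
| "kalman_cov A \<gamma> C\<^sub>0 (Suc n) =
     (\<lambda>x. kalman_cov A \<gamma> C\<^sub>0 n x
        - kalman_gain A \<gamma> (kalman_cov A \<gamma> C\<^sub>0 n) (A (kalman_cov A \<gamma> C\<^sub>0 n x)))"

text \<open>The process \<open>m\<close> is the sequence of filter means for the data \<open>y\<close>, which are generalised
  random elements, as is the innovation \<open>y\<^sub>n - A m\<^sub>n\<^sub>-\<^sub>1\<close>. The gain in step \<open>Suc n\<close> is formed from
  the covariance of step \<open>n\<close>.\<close>

definition kalman_mean ::
  "'w measure \<Rightarrow> ('x::real_inner \<Rightarrow> 'y::real_inner) \<Rightarrow> real \<Rightarrow> ('x \<Rightarrow> 'x) \<Rightarrow> 'x \<Rightarrow>
     (nat \<Rightarrow> 'y \<Rightarrow> 'w \<Rightarrow> real) \<Rightarrow> (nat \<Rightarrow> 'w \<Rightarrow> 'x) \<Rightarrow> bool" where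
  "kalman_mean M A \<gamma> C\<^sub>0 m\<^sub>0 y m \<longleftrightarrow>
     (\<forall>w\<in>space M. m 0 w = m\<^sub>0) \<and>
     (\<forall>n. \<exists>Z. is_image_of M (kalman_gain A \<gamma> (kalman_cov A \<gamma> C\<^sub>0 n))
                (\<lambda>h w. y (Suc n) h w - A (m n w) \<bullet> h) Z \<and>
              (\<forall>w\<in>space M. m (Suc n) w = m n w + Z w))"

text \<open>The same draw \<open>\<eta>\<close> is used in every step.\<close>

definition data_model_2 ::
  "('x \<Rightarrow> 'y::real_inner) \<Rightarrow> 'x \<Rightarrow> ('y \<Rightarrow> 'w \<Rightarrow> real) \<Rightarrow> nat \<Rightarrow> 'y \<Rightarrow> 'w \<Rightarrow> real" where
  "data_model_2 A u \<eta> n = (\<lambda>h w. A u \<bullet> h + \<eta> h w)"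

end

theory Submission
  imports Defs
begin

text \<open>
  The recursion for the covariance gives \<open>\<alpha> C\<^sub>n + n \<Sigma>\<^sub>0 A\<^sup>*A C\<^sub>n = \<gamma>\<^sup>2 \<Sigma>\<^sub>0\<close>, and since every step uses the
  same data, \<open>m\<^sub>n - u = r\<^sub>n (m\<^sub>0 - u) + (n/\<gamma>\<^sup>2) C\<^sub>n A\<^sup>*\<eta>\<close> with \<open>r\<^sub>n = I - (n/\<gamma>\<^sup>2) C\<^sub>n A\<^sup>*A\<close>, a Tikhonov residual:
  \<open>r\<^sub>n x + t \<Sigma>\<^sub>0 A\<^sup>*A r\<^sub>n x = x\<close> for \<open>t = n/\<alpha>\<close>. Tested against an orthonormal basis, the noise
  contributes at most \<open>(n \<gamma>\<^sup>2/\<alpha>) \<langle>\<Sigma>\<^sub>0 e, e\<rangle>\<close> in the direction \<open>e\<close>, which sums to the trace.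

  For the bias, split \<open>m\<^sub>0 - u\<close> in the eigenbasis of \<open>\<Sigma>\<^sub>0\<close> at the eigenvalue \<open>l = t\<^sup>-\<^sup>1\<^sup>/\<^sup>(\<^sup>a\<^sup>+\<^sup>1\<^sup>)\<close>. The part above
  \<open>l\<close> is smooth and the energy identity for \<open>r\<^sub>n\<close> gives the optimal rate; for the part \<open>w\<close> below \<open>l\<close>
  the energy identity for \<open>w - r\<^sub>n w\<close> together with the smallness of \<open>A w\<close> suffices. This replaces
  the usual appeal to Heinz' inequality and needs only powers of \<open>\<Sigma>\<^sub>0\<close>, which are diagonal.
\<close>

section \<open>Orthonormal bases in Hilbert spaces\<close>

definition orthonormal :: "'x::real_inner set \<Rightarrow> bool" where
  "orthonormal E \<longleftrightarrow> pairwise orthogonal E \<and> (\<forall>e\<in>E. norm e = 1)"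

lemma orthonormal_basis_iff: "orthonormal_basis E \<longleftrightarrow> orthonormal E \<and> closure (span E) = UNIV"
  by (auto simp: orthonormal_basis_def orthonormal_def)

lemma orthonormal_inner:
  assumes "orthonormal E" "e \<in> E" "f \<in> E"
  shows "e \<bullet> f = (if e = f then 1 else 0)"
  using assms by (auto simp: orthonormal_def pairwise_def orthogonal_def dot_square_norm)

lemma norm_sum_orthonormal:
  assumes "orthonormal E" "finite F" "F \<subseteq> E"
  shows "(norm (\<Sum>e\<in>F. c e *\<^sub>R e))\<^sup>2 = (\<Sum>e\<in>F. (c e)\<^sup>2)"
proof -
  have "pairwise (\<lambda>i j. orthogonal (c i *\<^sub>R i) (c j *\<^sub>R j)) F"
    using assms by (auto simp: orthonormal_def pairwise_def orthogonal_def)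
  then have "(norm (\<Sum>e\<in>F. c e *\<^sub>R e))\<^sup>2 = (\<Sum>e\<in>F. (norm (c e *\<^sub>R e))\<^sup>2)"
    by (rule norm_sum_Pythagorean[OF assms(2)])
  also have "\<dots> = (\<Sum>e\<in>F. (c e)\<^sup>2)"
    using assms by (intro sum.cong) (auto simp: orthonormal_def)
  finally show ?thesis .
qed

lemma inner_sum_orthonormal:
  assumes "orthonormal E" "finite F" "F \<subseteq> E" "e \<in> E"
  shows "(\<Sum>f\<in>F. c f *\<^sub>R f) \<bullet> e = (if e \<in> F then c e else 0)"
proof -
  have "(\<Sum>f\<in>F. c f *\<^sub>R f) \<bullet> e = (\<Sum>f\<in>F. if f = e then c f else 0)"
    unfolding inner_sum_left
    by (intro sum.cong) (use assms orthonormal_inner[OF assms(1)] in auto)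
  then show ?thesis using assms(2) by simp
qed

lemma bessel_inequality:
  assumes "orthonormal E" "finite F" "F \<subseteq> E"
  shows "(\<Sum>e\<in>F. (x \<bullet> e)\<^sup>2) \<le> (norm x)\<^sup>2"
proof -
  define y where "y = (\<Sum>e\<in>F. (x \<bullet> e) *\<^sub>R e)"
  have "x \<bullet> y = (\<Sum>e\<in>F. (x \<bullet> e)\<^sup>2)"
    by (simp add: y_def inner_sum_right power2_eq_square)
  moreover have "y \<bullet> y = (\<Sum>e\<in>F. (x \<bullet> e)\<^sup>2)"
    using norm_sum_orthonormal[OF assms] by (simp add: y_def dot_square_norm)
  moreover have "0 \<le> (x - y) \<bullet> (x - y)" by simp
  ultimately show ?thesis
    by (simp add: inner_diff inner_commute flip: dot_square_norm)
qed

text \<open>Pythagoras turns the squared distance of two nested finite partial sums into a block of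
  the sum of \<open>(c e)^2\<close>, so the net of partial sums is Cauchy and completeness supplies
  the limit.\<close>

lemma orthonormal_summable:
  fixes E :: "'x::{real_inner, complete_space} set"
  assumes E: "orthonormal E" and c: "(\<lambda>e. (c e)\<^sup>2) summable_on E"
  shows "(\<lambda>e. c e *\<^sub>R e) summable_on E"
proof -
  let ?f = "\<lambda>e. c e *\<^sub>R e"
  obtain L where L: "((\<lambda>e. (c e)\<^sup>2) has_sum L) E" using c by (auto simp: summable_on_def)
  have "\<exists>P. eventually P (finite_subsets_at_top E) \<and>
          (\<forall>F F'. P F \<and> P F' \<longrightarrow> dist (sum ?f F) (sum ?f F') < \<epsilon>)" if "\<epsilon> > 0" for \<epsilon>
  proof -
    have "eventually (\<lambda>F. dist (sum (\<lambda>e. (c e)\<^sup>2) F) L < (\<epsilon>/2)\<^sup>2) (finite_subsets_at_top E)"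
      using L that unfolding has_sum_def tendsto_iff
      by (metis half_gt_zero_iff zero_less_power)
    then obtain F0 where F0: "finite F0" "F0 \<subseteq> E"
      and close: "\<And>F. finite F \<Longrightarrow> F0 \<subseteq> F \<Longrightarrow> F \<subseteq> E \<Longrightarrow> dist (sum (\<lambda>e. (c e)\<^sup>2) F) L < (\<epsilon>/2)\<^sup>2"
      by (auto simp: eventually_finite_subsets_at_top)
    have near: "dist (sum ?f F) (sum ?f F0) < \<epsilon>/2" if F: "finite F" "F0 \<subseteq> F" "F \<subseteq> E" for F
    proof -
      have "(dist (sum ?f F) (sum ?f F0))\<^sup>2 = (norm (sum ?f (F - F0)))\<^sup>2"
        unfolding dist_norm using F F0 by (subst sum_diff) auto
      also have "\<dots> = (\<Sum>e\<in>F - F0. (c e)\<^sup>2)"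
        using F by (intro norm_sum_orthonormal[OF E]) auto
      also have "\<dots> = (\<Sum>e\<in>F. (c e)\<^sup>2) - (\<Sum>e\<in>F0. (c e)\<^sup>2)"
        using F F0 by (subst sum_diff) auto
      also have "\<dots> < (\<epsilon>/2)\<^sup>2"
      proof -
        have "sum (\<lambda>e. (c e)\<^sup>2) F \<le> L"
          using F by (intro finite_sum_le_has_sum[OF L]) auto
        then show ?thesis using close[OF F0(1) _ F0(2)] by (auto simp: dist_real_def)
      qed
      finally show ?thesis
        using \<open>\<epsilon> > 0\<close> by (intro power_less_imp_less_base[of _ 2 "\<epsilon>/2"]) auto
    qed
    show ?thesis
    proof (intro exI conjI allI impI)
      show "eventually (\<lambda>F. finite F \<and> F0 \<subseteq> F \<and> F \<subseteq> E) (finite_subsets_at_top E)"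
        using F0 by (auto simp: eventually_finite_subsets_at_top)
      fix F F' assume "(finite F \<and> F0 \<subseteq> F \<and> F \<subseteq> E) \<and> finite F' \<and> F0 \<subseteq> F' \<and> F' \<subseteq> E"
      then show "dist (sum ?f F) (sum ?f F') < \<epsilon>"
        by (intro dist_triangle_half_l[OF near near]) auto
    qed
  qed
  then have "cauchy_filter (filtermap (sum ?f) (finite_subsets_at_top E))"
    by (simp add: cauchy_filter_metric_filtermap)
  then obtain y where "(sum ?f \<longlongrightarrow> y) (finite_subsets_at_top E)"
    using complete_uniform[where S="UNIV::'x set"] complete_UNIV by (force simp add: filterlim_def)
  then show ?thesis
    using summable_on_def has_sum_def by blast
qed

lemma orthonormal_has_sum_inner:
  assumes E: "orthonormal E" and x: "((\<lambda>e. c e *\<^sub>R e) has_sum x) E" and e: "e \<in> E"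
  shows "x \<bullet> e = c e"
proof -
  have "((\<lambda>f. (c f *\<^sub>R f) \<bullet> e) has_sum x \<bullet> e) E"
    by (rule has_sum_bounded_linear[OF bounded_linear_inner_left x])
  moreover have "((\<lambda>f. (c f *\<^sub>R f) \<bullet> e) has_sum c e) E"
    by (rule has_sum_finite_neutralI[of "{e}"])
       (use e orthonormal_inner[OF E] in \<open>auto split: if_splits\<close>)
  ultimately show ?thesis by (rule has_sum_unique)
qed

lemma orthonormal_has_sum_norm:
  assumes E: "orthonormal E" and x: "((\<lambda>e. c e *\<^sub>R e) has_sum x) E"
  shows "((\<lambda>e. (c e)\<^sup>2) has_sum (norm x)\<^sup>2) E"
proof -
  have "((\<lambda>e. (c e *\<^sub>R e) \<bullet> x) has_sum x \<bullet> x) E"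
    by (rule has_sum_bounded_linear[OF bounded_linear_inner_left x])
  then have "((\<lambda>e. (c e *\<^sub>R e) \<bullet> x) has_sum (norm x)\<^sup>2) E"
    by (simp add: dot_square_norm)
  then show ?thesis
    by (rule has_sum_cong[THEN iffD1, rotated])
       (simp add: inner_commute[of _ x] orthonormal_has_sum_inner[OF E x] power2_eq_square)
qed

lemma bessel_summable:
  assumes "orthonormal E"
  shows "(\<lambda>e. (x \<bullet> e)\<^sup>2) summable_on E"
  by (rule nonneg_bounded_partial_sums_imp_summable_on[of _ _ "(norm x)\<^sup>2"])
     (auto intro!: eventually_finite_subsets_at_top_weakI bessel_inequality[OF assms])

text \<open>The Fourier series of \<open>x\<close> converges to the orthogonal projection onto the
  closed span. The remainder is orthogonal to \<open>E\<close>, which is how maximality of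
  \<open>E\<close> becomes density of its span.\<close>

lemma orthonormal_projection:
  fixes E :: "'x::{real_inner, complete_space} set"
  assumes E: "orthonormal E"
  obtains y where "((\<lambda>e. (x \<bullet> e) *\<^sub>R e) has_sum y) E" "y \<in> closure (span E)"
    "\<And>e. e \<in> E \<Longrightarrow> (x - y) \<bullet> e = 0"
proof -
  obtain y where y: "((\<lambda>e. (x \<bullet> e) *\<^sub>R e) has_sum y) E"
    using orthonormal_summable[OF E bessel_summable[OF E]] by (auto simp: summable_on_def)
  have "y \<in> closure (span E)"
  proof (rule Lim_in_closed_set[OF closed_closure])
    show "(sum (\<lambda>e. (x \<bullet> e) *\<^sub>R e) \<longlongrightarrow> y) (finite_subsets_at_top E)"
      using y by (simp add: has_sum_def)
    show "eventually (\<lambda>F. sum (\<lambda>e. (x \<bullet> e) *\<^sub>R e) F \<in> closure (span E)) (finite_subsets_at_top E)"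
      by (intro eventually_finite_subsets_at_top_weakI subsetD[OF closure_subset] span_sum span_scale span_base) auto
  qed simp
  moreover have "(x - y) \<bullet> e = 0" if "e \<in> E" for e
    using orthonormal_has_sum_inner[OF E y that] by (simp add: inner_diff_left)
  ultimately show ?thesis using that y by blast
qed

lemma orthonormal_basisI:
  fixes E :: "'x::{real_inner, complete_space} set"
  assumes E: "orthonormal E" and max: "\<And>x. (\<And>e. e \<in> E \<Longrightarrow> x \<bullet> e = 0) \<Longrightarrow> x = 0"
  shows "orthonormal_basis E"
proof -
  have "x \<in> closure (span E)" for x
  proof -
    obtain y where "y \<in> closure (span E)" "\<And>e. e \<in> E \<Longrightarrow> (x - y) \<bullet> e = 0"
      using orthonormal_projection[OF E, of x] by metis
    then show ?thesis using max[of "x - y"] by simp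
  qed
  then show ?thesis using E by (auto simp: orthonormal_basis_iff)
qed

lemma orthonormal_basis_orthogonal_eq_0:
  assumes E: "orthonormal_basis E" and x: "\<And>e. e \<in> E \<Longrightarrow> x \<bullet> e = 0"
  shows "x = 0"
proof -
  have "span E \<subseteq> {y. x \<bullet> y = 0}"
    by (rule span_minimal) (auto simp: x subspace_def inner_add_right)
  moreover have "closed {y. x \<bullet> y = 0}"
    by (intro closed_Collect_eq continuous_intros)
  ultimately have "closure (span E) \<subseteq> {y. x \<bullet> y = 0}" by (rule closure_minimal)
  moreover have "x \<in> closure (span E)" using E by (simp add: orthonormal_basis_def)
  ultimately have "x \<bullet> x = 0" by blast
  then show ?thesis by simp
qed

lemma orthonormal_basis_expansion:
  fixes E :: "'x::{real_inner, complete_space} set"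
  assumes E: "orthonormal_basis E"
  shows "((\<lambda>e. (x \<bullet> e) *\<^sub>R e) has_sum x) E"
proof -
  have "orthonormal E" using E by (simp add: orthonormal_basis_iff)
  then obtain y where y: "((\<lambda>e. (x \<bullet> e) *\<^sub>R e) has_sum y) E" "\<And>e. e \<in> E \<Longrightarrow> (x - y) \<bullet> e = 0"
    using orthonormal_projection[of E x] by metis
  then have "x - y = 0" by (intro orthonormal_basis_orthogonal_eq_0[OF E])
  then show ?thesis using y by simp
qed

lemma parseval:
  fixes E :: "'x::{real_inner, complete_space} set"
  assumes "orthonormal_basis E"
  shows "((\<lambda>e. (x \<bullet> e)\<^sup>2) has_sum (norm x)\<^sup>2) E"
  using assms orthonormal_has_sum_norm orthonormal_basis_expansion orthonormal_basis_iff by blast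

lemma parseval_inner:
  fixes E :: "'x::{real_inner, complete_space} set"
  assumes "orthonormal_basis E"
  shows "((\<lambda>e. (x \<bullet> e) * (e \<bullet> y)) has_sum x \<bullet> y) E"
  using has_sum_bounded_linear[OF bounded_linear_inner_left orthonormal_basis_expansion[OF assms, of x], of y]
  by simp

text \<open>\<open>adjoint\<close> is defined by choice and satisfies its equation only once some
  adjoint is known to exist. One is built as in the Riesz theorem: the vector for \<open>y\<close>
  has the coefficients \<open>A e \<bullet> y\<close>.\<close>

lemma adjoint_works_hilbert:
  fixes A :: "'x::{real_inner, complete_space} \<Rightarrow> 'y::real_inner" and E :: "'x set"
  assumes E: "orthonormal_basis E" and A: "bounded_linear A"
  shows "A x \<bullet> y = x \<bullet> adjoint A y"
proof -
  interpret bounded_linear A by fact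
  obtain K where K: "K > 0" "\<And>x. norm (A x) \<le> norm x * K" using pos_bounded by blast
  have on: "orthonormal E" using E by (simp add: orthonormal_basis_iff)
  have "\<exists>z. \<forall>x. A x \<bullet> y = x \<bullet> z" for y :: 'y
  proof -
    have "(\<Sum>e\<in>F. (A e \<bullet> y)\<^sup>2) \<le> (K * norm y)\<^sup>2" if F: "finite F" "F \<subseteq> E" for F
    proof -
      \<comment> \<open>Feeding this partial sum of the Riesz vector back into \<open>A\<close>
        gives \<open>norm v ^ 2 = A v \<bullet> y \<le> norm v * (K * norm y)\<close>. Cancelling
        \<open>norm v\<close> bounds all partial sums of squares uniformly.\<close>
      define v where "v = (\<Sum>e\<in>F. (A e \<bullet> y) *\<^sub>R e)"
      have nv: "(norm v)\<^sup>2 = (\<Sum>e\<in>F. (A e \<bullet> y)\<^sup>2)"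
        unfolding v_def by (rule norm_sum_orthonormal[OF on F])
      have "(\<Sum>e\<in>F. (A e \<bullet> y)\<^sup>2) = A v \<bullet> y"
        by (simp add: v_def sum scaleR inner_sum_left power2_eq_square)
      also have "\<dots> \<le> norm (A v) * norm y" by (rule norm_cauchy_schwarz)
      also have "\<dots> \<le> norm v * (K * norm y)"
        using mult_right_mono[OF K(2)[of v] norm_ge_zero[of y]] by (simp add: mult.assoc)
      finally have "norm v * norm v \<le> norm v * (K * norm y)"
        using nv by (simp add: power2_eq_square)
      then have "norm v \<le> K * norm y"
        using K(1) by (cases "v = 0") (auto simp: mult_le_cancel_left)
      then show ?thesis using nv power_mono[of "norm v" "K * norm y" 2] by simp
    qed
    then have "(\<lambda>e. (A e \<bullet> y)\<^sup>2) summable_on E"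
      by (intro nonneg_bounded_partial_sums_imp_summable_on[of _ _ "(K * norm y)\<^sup>2"])
         (auto intro!: eventually_finite_subsets_at_top_weakI)
    then obtain z where z: "((\<lambda>e. (A e \<bullet> y) *\<^sub>R e) has_sum z) E"
      using orthonormal_summable[OF on, of "\<lambda>e. A e \<bullet> y"] unfolding summable_on_def by blast
    have "A x \<bullet> y = x \<bullet> z" for x
    proof -
      have "((\<lambda>e. A ((x \<bullet> e) *\<^sub>R e) \<bullet> y) has_sum A x \<bullet> y) E"
        by (intro has_sum_bounded_linear[OF bounded_linear_inner_left]
            has_sum_bounded_linear[OF A] orthonormal_basis_expansion[OF E])
      moreover have "((\<lambda>e. x \<bullet> ((A e \<bullet> y) *\<^sub>R e)) has_sum x \<bullet> z) E"
        by (intro has_sum_bounded_linear[OF bounded_linear_inner_right] z)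
      ultimately show ?thesis
        by (simp add: scaleR mult.commute has_sum_unique)
    qed
    then show ?thesis by blast
  qed
  then obtain g where g: "A x \<bullet> y = x \<bullet> g y" for x y by metis
  then have "adjoint A = g" by (intro adjoint_unique) simp
  then show ?thesis using g by simp
qed

lemma bounded_linear_adjoint:
  fixes A :: "'x::real_inner \<Rightarrow> 'y::real_inner"
  assumes A: "bounded_linear A" and adj: "\<And>x y. A x \<bullet> y = x \<bullet> adjoint A y"
  shows "bounded_linear (adjoint A)"
proof -
  interpret bounded_linear A by fact
  have ext: "u = v" if "\<And>x. x \<bullet> u = x \<bullet> v" for u v :: 'x
  proof -
    have "(u - v) \<bullet> (u - v) = 0" unfolding inner_diff_right using that[of "u - v"] by simp
    then show ?thesis by simp
  qed
  obtain K where K: "K > 0" "\<And>x. norm (A x) \<le> norm x * K" using pos_bounded by blast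
  show ?thesis
  proof (rule bounded_linear_intro[of _ K])
    show "adjoint A (y + y') = adjoint A y + adjoint A y'" for y y'
      by (rule ext) (simp add: inner_add_right flip: adj)
    show "adjoint A (r *\<^sub>R y) = r *\<^sub>R adjoint A y" for r y
      by (rule ext) (simp flip: adj)
    show "norm (adjoint A y) \<le> norm y * K" for y
    proof -
      have "norm (adjoint A y) * norm (adjoint A y) = A (adjoint A y) \<bullet> y"
        by (simp add: adj dot_square_norm power2_eq_square)
      also have "\<dots> \<le> norm (A (adjoint A y)) * norm y" by (rule norm_cauchy_schwarz)
      also have "\<dots> \<le> norm (adjoint A y) * K * norm y" by (intro mult_right_mono K) auto
      finally have "norm (adjoint A y) * norm (adjoint A y) \<le> norm (adjoint A y) * (norm y * K)"
        by (simp add: mult_ac)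
      then show ?thesis
        by (cases "adjoint A y = 0") (use K(1) in \<open>auto simp: mult_le_cancel_left\<close>)
    qed
  qed
qed

section \<open>Spectral theorem for positive trace class operators\<close>

lemma pos_selfadjoint_bounded_linear: "pos_selfadjoint S \<Longrightarrow> bounded_linear S"
  and pos_selfadjoint_sym: "pos_selfadjoint S \<Longrightarrow> S x \<bullet> y = x \<bullet> S y"
  and pos_selfadjoint_nonneg: "pos_selfadjoint S \<Longrightarrow> 0 \<le> S x \<bullet> x"
  by (auto simp: pos_selfadjoint_def)

text \<open>The form may be degenerate, so the discriminant argument has a separate case
  \<open>S y \<bullet> y = 0\<close>: there the form is affine in the coefficient of
  \<open>y\<close>, and nonnegativity makes the slope vanish.\<close>

lemma pos_selfadjoint_cauchy_schwarz:
  assumes S: "pos_selfadjoint S"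
  shows "(S x \<bullet> y)\<^sup>2 \<le> (S x \<bullet> x) * (S y \<bullet> y)"
proof -
  interpret bounded_linear S by (rule pos_selfadjoint_bounded_linear[OF S])
  define b where "b = S x \<bullet> y"
  have sym: "S y \<bullet> x = b" using pos_selfadjoint_sym[OF S] by (simp add: b_def inner_commute)
  have expand: "0 \<le> t\<^sup>2 * (S x \<bullet> x) + 2 * t * r * b + r\<^sup>2 * (S y \<bullet> y)" for t r
  proof -
    have "0 \<le> S (t *\<^sub>R x + r *\<^sub>R y) \<bullet> (t *\<^sub>R x + r *\<^sub>R y)" by (rule pos_selfadjoint_nonneg[OF S])
    also have "\<dots> = t\<^sup>2 * (S x \<bullet> x) + 2 * t * r * b + r\<^sup>2 * (S y \<bullet> y)"
      by (simp add: add scaleR inner_add_left inner_add_right sym flip: b_def)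
         (simp add: algebra_simps power2_eq_square)
    finally show ?thesis .
  qed
  show ?thesis
  proof (cases "S y \<bullet> y = 0")
    case False
    then have pos: "0 < S y \<bullet> y" using pos_selfadjoint_nonneg[OF S, of y] by simp
    have "0 \<le> (S y \<bullet> y) * ((S x \<bullet> x) * (S y \<bullet> y) - b\<^sup>2)"
      using expand[of "S y \<bullet> y" "- b"] by (simp add: algebra_simps power2_eq_square)
    then show ?thesis using pos by (simp add: zero_le_mult_iff b_def)
  next
    case True
    have "b = 0"
    proof (rule ccontr)
      assume "b \<noteq> 0"
      \<comment> \<open>At this coefficient the form would equal -1.\<close>
      then show False using expand[of 1 "- (S x \<bullet> x + 1) / (2 * b)"] True by (simp add: field_simps)
    qed
    then show ?thesis using True by (simp add: b_def)
  qed
qed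

text \<open>Cauchy-Schwarz for the form at \<open>x\<close> and \<open>S x\<close>, with a factor
  \<open>norm (S x) ^ 2\<close> cancelled. The bound \<open>M\<close> enters only at
  \<open>S x\<close>, so it may come from a subspace that \<open>S\<close> maps into itself.\<close>

lemma pos_selfadjoint_norm_sq_le:
  assumes S: "pos_selfadjoint S" and M: "S (S x) \<bullet> S x \<le> M * (norm (S x))\<^sup>2"
  shows "(norm (S x))\<^sup>2 \<le> M * (S x \<bullet> x)"
proof (cases "S x = 0")
  case False
  have "(norm (S x))\<^sup>2 * (norm (S x))\<^sup>2 = (S x \<bullet> S x)\<^sup>2"
    by (simp add: dot_square_norm power2_eq_square)
  also have "\<dots> \<le> (S x \<bullet> x) * (S (S x) \<bullet> S x)" by (rule pos_selfadjoint_cauchy_schwarz[OF S])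
  also have "\<dots> \<le> (S x \<bullet> x) * (M * (norm (S x))\<^sup>2)"
    by (intro mult_left_mono M pos_selfadjoint_nonneg[OF S])
  finally have "(norm (S x))\<^sup>2 * (norm (S x))\<^sup>2 \<le> (norm (S x))\<^sup>2 * (M * (S x \<bullet> x))"
    by (simp add: algebra_simps)
  then show ?thesis using False by (auto simp only: mult_le_cancel_left zero_less_power2 norm_eq_zero)
qed simp

lemma pos_selfadjoint_form_bound:
  assumes "pos_selfadjoint S"
  obtains K where "K > 0" "\<And>x. S x \<bullet> x \<le> K * (norm x)\<^sup>2" "\<And>x. (norm (S x))\<^sup>2 \<le> K * (S x \<bullet> x)"
proof -
  interpret bounded_linear S by (rule pos_selfadjoint_bounded_linear[OF assms])
  obtain K where K: "K > 0" "\<And>x. norm (S x) \<le> norm x * K" using pos_bounded by blast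
  have 1: "S x \<bullet> x \<le> K * (norm x)\<^sup>2" for x
    using norm_cauchy_schwarz[of "S x" x] mult_right_mono[OF K(2)[of x] norm_ge_zero[of x]]
    by (simp add: power2_eq_square algebra_simps)
  show ?thesis using that[OF K(1) 1 pos_selfadjoint_norm_sq_le[OF assms 1]] .
qed

text \<open>This stands in for compactness of \<open>S\<close>. The set \<open>F\<close> carries the
  trace up to \<epsilon>, and Cauchy-Schwarz bounds \<open>(S x \<bullet> e)^2\<close> by
  \<open>(S x \<bullet> x) * (S e \<bullet> e)\<close>.\<close>

lemma trace_class_form_tail:
  fixes E :: "'x::{real_inner, complete_space} set"
  assumes S: "pos_selfadjoint S" and E: "orthonormal_basis E"
    and sum: "(\<lambda>e. S e \<bullet> e) summable_on E" and \<epsilon>: "0 < \<epsilon>"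
  obtains F where "finite F" "F \<subseteq> E"
    "\<And>x. (\<And>e. e \<in> F \<Longrightarrow> x \<bullet> e = 0) \<Longrightarrow> S x \<bullet> x \<le> \<epsilon> * (norm x)\<^sup>2"
proof -
  obtain F where F: "finite F" "F \<subseteq> E" "dist (\<Sum>e\<in>F. S e \<bullet> e) (\<Sum>\<^sub>\<infinity>e\<in>E. S e \<bullet> e) \<le> \<epsilon>"
    using infsum_finite_approximation[OF sum \<epsilon>] by metis
  have tail: "((\<lambda>e. S e \<bullet> e) has_sum (\<Sum>\<^sub>\<infinity>e\<in>E. S e \<bullet> e) - (\<Sum>e\<in>F. S e \<bullet> e)) (E - F)"
    using has_sum_Diff[OF has_sum_infsum[OF sum] has_sum_finite[OF F(1), of "\<lambda>e. S e \<bullet> e"] F(2)] .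
  define \<tau> where "\<tau> = (\<Sum>\<^sub>\<infinity>e\<in>E. S e \<bullet> e) - (\<Sum>e\<in>F. S e \<bullet> e)"
  have \<tau>: "\<tau> \<le> \<epsilon>" using F(3) by (simp add: \<tau>_def dist_real_def)
  have "S x \<bullet> x \<le> \<epsilon> * (norm x)\<^sup>2" if x: "\<And>e. e \<in> F \<Longrightarrow> x \<bullet> e = 0" for x
  proof -
    have restrict: "((\<lambda>e. g e) has_sum v) (E - F)" if "(g has_sum v) E" "\<And>e. e \<in> F \<Longrightarrow> g e = 0"
      for g :: "'x \<Rightarrow> real" and v
      by (rule has_sum_cong_neutral[THEN iffD1, OF _ _ _ that(1)]) (use that(2) in auto)
    have "((\<lambda>e. (x \<bullet> e) * (e \<bullet> S x)) has_sum x \<bullet> S x) (E - F)"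
      by (rule restrict[OF parseval_inner[OF E]]) (use x in auto)
    \<comment> \<open>Young's inequality with weight \<epsilon> in each term of
      \<open>x \<bullet> S x\<close>. The second parts sum to at most half of
      \<open>S x \<bullet> x\<close>, which the left side absorbs.\<close>
    moreover have "((\<lambda>e. (\<epsilon> * (x \<bullet> e)\<^sup>2 + (1 / \<epsilon>) * (S x \<bullet> x) * (S e \<bullet> e)) / 2) has_sum
        (\<epsilon> * (norm x)\<^sup>2 + (1 / \<epsilon>) * (S x \<bullet> x) * \<tau>) / 2) (E - F)"
      unfolding \<tau>_def
      by (intro has_sum_divide_const has_sum_add has_sum_cmult_right tail restrict parseval[OF E])
         (use x in auto)
    ultimately have "x \<bullet> S x \<le> (\<epsilon> * (norm x)\<^sup>2 + (1 / \<epsilon>) * (S x \<bullet> x) * \<tau>) / 2"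
    proof (rule has_sum_mono)
      fix e
      have "0 \<le> (\<epsilon> * (x \<bullet> e) - S x \<bullet> e)\<^sup>2 / \<epsilon>" using \<epsilon> by simp
      also have "\<dots> = \<epsilon> * (x \<bullet> e)\<^sup>2 - 2 * (x \<bullet> e) * (S x \<bullet> e) + (S x \<bullet> e)\<^sup>2 / \<epsilon>"
        using \<epsilon> by (simp add: power2_eq_square field_simps)
      also have "\<dots> \<le> \<epsilon> * (x \<bullet> e)\<^sup>2 - 2 * (x \<bullet> e) * (S x \<bullet> e) + (S x \<bullet> x) * (S e \<bullet> e) / \<epsilon>"
        using pos_selfadjoint_cauchy_schwarz[OF S, of x e] \<epsilon> by (simp add: divide_right_mono)
      finally show "(x \<bullet> e) * (e \<bullet> S x) \<le> (\<epsilon> * (x \<bullet> e)\<^sup>2 + (1 / \<epsilon>) * (S x \<bullet> x) * (S e \<bullet> e)) / 2"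
        by (simp add: inner_commute)
    qed
    moreover have "(1 / \<epsilon>) * (S x \<bullet> x) * \<tau> \<le> S x \<bullet> x"
    proof -
      have "(S x \<bullet> x) * \<tau> \<le> (S x \<bullet> x) * \<epsilon>"
        by (intro mult_left_mono \<tau> pos_selfadjoint_nonneg[OF S])
      then show ?thesis using \<epsilon> by (simp add: field_simps)
    qed
    ultimately show ?thesis by (simp add: inner_commute)
  qed
  then show ?thesis using that F by blast
qed

lemma convergent_inner_subsequence:
  fixes X :: "nat \<Rightarrow> 'x::real_inner"
  assumes "finite F" and X: "\<And>k. norm (X k) \<le> B"
  obtains r :: "nat \<Rightarrow> nat" where "strict_mono r" "\<And>e. e \<in> F \<Longrightarrow> convergent (\<lambda>k. X (r k) \<bullet> e)"
  using assms(1)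
proof (induction F arbitrary: thesis rule: finite_induct)
  case empty
  show ?case by (rule empty(1)[of id]) (auto simp: strict_mono_def)
next
  case (insert f F)
  obtain r :: "nat \<Rightarrow> nat" where r: "strict_mono r" "\<And>e. e \<in> F \<Longrightarrow> convergent (\<lambda>k. X (r k) \<bullet> e)"
    using insert.IH by blast
  have "bounded (range (\<lambda>k. X (r k) \<bullet> f))"
  proof (rule boundedI)
    fix y assume "y \<in> range (\<lambda>k. X (r k) \<bullet> f)"
    then obtain k where "y = X (r k) \<bullet> f" by blast
    then show "norm y \<le> B * norm f"
      using Cauchy_Schwarz_ineq2[of "X (r k)" f] mult_right_mono[OF X[of "r k"] norm_ge_zero[of f]] by simp
  qed
  then obtain l q where q: "strict_mono q" "((\<lambda>k. X (r k) \<bullet> f) \<circ> q) \<longlonglongrightarrow> l"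
    using bounded_imp_convergent_subsequence by blast
  have "strict_mono (r \<circ> q)" by (rule strict_mono_o[OF r(1) q(1)])
  moreover have "convergent (\<lambda>k. X ((r \<circ> q) k) \<bullet> e)" if "e \<in> insert f F" for e
  proof (cases "e = f")
    case True
    then show ?thesis using q(2) by (auto simp: convergent_def o_def)
  next
    case False
    then have "convergent (\<lambda>k. X (r k) \<bullet> e)" using that r(2) by auto
    then obtain l where "(\<lambda>k. X (r k) \<bullet> e) \<longlonglongrightarrow> l" by (auto simp: convergent_def)
    from LIMSEQ_subseq_LIMSEQ[OF this q(1)] show ?thesis by (auto simp: convergent_def o_def)
  qed
  ultimately show ?case by (rule insert.prems)
qed

text \<open>The form is maximised on the unit sphere of \<open>V\<close>. A maximising sequence
  consists of approximate eigenvectors for the supremum, and smallness of \<open>S\<close> off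
  finitely many directions makes a subsequence converge in norm.\<close>

lemma trace_class_eigenvector:
  fixes S :: "'x::{real_inner, complete_space} \<Rightarrow> 'x"
  assumes S: "pos_selfadjoint S" and tr: "pos_trace_class S"
    and V: "subspace V" "closed V" "\<And>v. v \<in> V \<Longrightarrow> S v \<in> V" and V0: "x0 \<in> V" "x0 \<noteq> 0"
  obtains v \<mu> where "v \<in> V" "norm v = 1" "S v = \<mu> *\<^sub>R v"
proof -
  interpret bounded_linear S by (rule pos_selfadjoint_bounded_linear[OF S])
  obtain E where E: "orthonormal_basis E" and sum_E: "(\<lambda>e. S e \<bullet> e) summable_on E"
    using tr by (auto simp: pos_trace_class_def)
  have on: "orthonormal E" using E by (simp add: orthonormal_basis_iff)
  obtain K where K: "K > 0" "\<And>x. S x \<bullet> x \<le> K * (norm x)\<^sup>2" "\<And>x. (norm (S x))\<^sup>2 \<le> K * (S x \<bullet> x)"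
    using pos_selfadjoint_form_bound[OF S] by metis
  define U where "U = {v \<in> V. norm v = 1}"
  define M where "M = (SUP v\<in>U. S v \<bullet> v)"
  have U_ne: "inverse (norm x0) *\<^sub>R x0 \<in> U"
    using V0 V(1) by (auto simp: U_def subspace_scale)
  have bdd: "bdd_above ((\<lambda>v. S v \<bullet> v) ` U)"
  proof (rule bdd_aboveI2)
    fix v assume "v \<in> U"
    then show "S v \<bullet> v \<le> K" using K(2)[of v] by (simp add: U_def)
  qed
  have M_unit: "S v \<bullet> v \<le> M" if "v \<in> U" for v
    unfolding M_def by (rule cSUP_upper[OF that bdd])
  have M: "S v \<bullet> v \<le> M * (norm v)\<^sup>2" if "v \<in> V" for v
  proof (cases "v = 0")
    case False
    then have "inverse (norm v) *\<^sub>R v \<in> U" using that V(1) by (auto simp: U_def subspace_scale)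
    from M_unit[OF this] show ?thesis
      using False by (simp add: scaleR power2_eq_square field_simps)
  qed (simp add: zero)
  have SM: "(norm (S v))\<^sup>2 \<le> M * (S v \<bullet> v)" if "v \<in> V" for v
    by (rule pos_selfadjoint_norm_sq_le[OF S M[OF V(3)[OF that]]])
  have M0: "0 \<le> M" using M_unit[OF U_ne] pos_selfadjoint_nonneg[OF S] by (rule order_trans[rotated])
  show ?thesis
  \<comment> \<open>The compactness argument needs a positive supremum. If it is 0, then
    \<open>S\<close> vanishes on \<open>V\<close> and any unit vector of \<open>V\<close> will
    do.\<close>
  proof (cases "M = 0")
    case True
    then have "S (inverse (norm x0) *\<^sub>R x0) = 0 *\<^sub>R (inverse (norm x0) *\<^sub>R x0)"
      using SM U_ne by (fastforce simp: U_def)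
    then show ?thesis using that[of "inverse (norm x0) *\<^sub>R x0" 0] U_ne unfolding U_def by blast
  next
    case False
    then have Mpos: "0 < M" using M0 by simp
    have "\<exists>v\<in>U. M - inverse (real (Suc k)) < S v \<bullet> v" for k
    proof -
      have "M - inverse (real (Suc k)) < M" by simp
      then show ?thesis
        unfolding M_def by (subst (asm) less_cSUP_iff[OF _ bdd]) (use U_ne in auto)
    qed
    then obtain X where XU: "\<And>k. X k \<in> U" and X: "\<And>k. M - inverse (real (Suc k)) < S (X k) \<bullet> X k"
      by metis
    have XV: "X k \<in> V" and X1: "norm (X k) = 1" for k using XU[of k] by (auto simp: U_def)
    have approx: "(\<lambda>k. S (X k) - M *\<^sub>R X k) \<longlonglongrightarrow> 0"
    proof -
      \<comment> \<open>After expanding the square,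
        \<open>norm (S v) ^ 2 \<le> M * (S v \<bullet> v)\<close> leaves at most
        \<open>M * (M - S v \<bullet> v)\<close>, which tends to 0 along the sequence.\<close>
      have bound: "(norm (S (X k) - M *\<^sub>R X k))\<^sup>2 \<le> M * inverse (real (Suc k))" for k
      proof -
        have "(norm (S (X k) - M *\<^sub>R X k))\<^sup>2 = (norm (S (X k)))\<^sup>2 - 2 * M * (S (X k) \<bullet> X k) + M\<^sup>2"
          using X1[of k]
          unfolding power2_norm_eq_inner norm_eq_1
          by (simp add: inner_diff_left inner_diff_right inner_commute power2_eq_square algebra_simps)
        also have "\<dots> \<le> M * (M - S (X k) \<bullet> X k)"
          using SM[OF XV, of k] by (simp add: algebra_simps power2_eq_square)
        also have "\<dots> \<le> M * inverse (real (Suc k))"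
          using X[of k] Mpos by (intro mult_left_mono) auto
        finally show ?thesis .
      qed
      have lim: "(\<lambda>k. M * inverse (real (Suc k))) \<longlonglongrightarrow> 0"
        using tendsto_mult_right_zero[OF LIMSEQ_inverse_real_of_nat] .
      have "(\<lambda>k. (norm (S (X k) - M *\<^sub>R X k))\<^sup>2) \<longlonglongrightarrow> 0"
        by (rule tendsto_sandwich[OF _ _ tendsto_const lim]) (use bound in auto)
      then have "(\<lambda>k. sqrt ((norm (S (X k) - M *\<^sub>R X k))\<^sup>2)) \<longlonglongrightarrow> sqrt 0"
        by (rule tendsto_real_sqrt)
      then show ?thesis by (simp add: tendsto_norm_zero_iff)
    qed
    \<comment> \<open>With this tolerance \<open>S\<close> shrinks vectors orthogonal to
      \<open>F\<close> at least to \<open>M / 2\<close> times their norm, so there it cannot cancel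
      the multiple \<open>M\<close>.\<close>
    have "0 < (M / 2)\<^sup>2 / K" using Mpos K(1) by simp
    then obtain F where F: "finite F" "F \<subseteq> E"
      "\<And>x. (\<And>e. e \<in> F \<Longrightarrow> x \<bullet> e = 0) \<Longrightarrow> S x \<bullet> x \<le> (M / 2)\<^sup>2 / K * (norm x)\<^sup>2"
      using trace_class_form_tail[OF S E sum_E] by metis
    have tail: "norm (S x) \<le> M / 2 * norm x" if "\<And>e. e \<in> F \<Longrightarrow> x \<bullet> e = 0" for x
    proof -
      have "(norm (S x))\<^sup>2 \<le> K * ((M / 2)\<^sup>2 / K * (norm x)\<^sup>2)"
        using K(3)[of x] F(3)[OF that] K(1) by (meson mult_left_mono less_imp_le order_trans)
      also have "\<dots> = (M / 2 * norm x)\<^sup>2"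
        using K(1) by (simp add: field_simps power2_eq_square)
      finally have "(norm (S x))\<^sup>2 \<le> (M / 2 * norm x)\<^sup>2" .
      then show ?thesis by (rule power2_le_imp_le) (use Mpos in auto)
    qed
    obtain r :: "nat \<Rightarrow> nat" where r: "strict_mono r"
      "\<And>e. e \<in> F \<Longrightarrow> convergent (\<lambda>k. X (r k) \<bullet> e)"
      using convergent_inner_subsequence[OF F(1), of X 1] X1 by auto
    define P where "P = (\<lambda>x. \<Sum>e\<in>F. (x \<bullet> e) *\<^sub>R e)"
    have P_perp: "(x - P x) \<bullet> e = 0" if "e \<in> F" for x e
      using that F inner_sum_orthonormal[OF on F(1,2), of e "\<lambda>e. x \<bullet> e"]
      by (auto simp: P_def inner_diff_left)
    have P_contr: "norm (x - P x) \<le> norm x" for x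
    proof -
      have "(x - y) \<bullet> P x = (\<Sum>e\<in>F. (x \<bullet> e) * ((x - y) \<bullet> e))" for y
        by (simp add: P_def inner_sum_right)
      then have "(x - P x) \<bullet> P x = 0" by (simp add: P_perp)
      then have "(norm x)\<^sup>2 = (norm (x - P x))\<^sup>2 + (norm (P x))\<^sup>2"
        using norm_add_Pythagorean[of "x - P x" "P x"] by (simp add: orthogonal_def)
      then have "(norm (x - P x))\<^sup>2 \<le> (norm x)\<^sup>2" by simp
      then show ?thesis by (rule power2_le_imp_le) simp
    qed
    have P_diff: "P (x - y) = P x - P y" for x y
      by (simp add: P_def inner_diff_left scaleR_diff_left sum_subtractf)
    \<comment> \<open>\<open>Z\<close> collects what is already known to converge: the part of
      \<open>S\<close> that sees finitely many coordinates, and the eigenvector defect. For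
      \<open>d = X (r k) - X (r l)\<close> one gets
      \<open>Z k - Z l = M *\<^sub>R d - S (d - P d)\<close>, whose last term has norm at most
      \<open>M / 2 * norm d\<close>.\<close>
    define Z where "Z k = S (P (X (r k))) - (S (X (r k)) - M *\<^sub>R X (r k))" for k
    have "convergent Z"
    proof -
      obtain p where p: "\<And>e. e \<in> F \<Longrightarrow> (\<lambda>k. X (r k) \<bullet> e) \<longlonglongrightarrow> p e"
        using r(2) unfolding convergent_def by metis
      have "(\<lambda>k. P (X (r k))) \<longlonglongrightarrow> (\<Sum>e\<in>F. p e *\<^sub>R e)"
        unfolding P_def by (intro tendsto_sum tendsto_scaleR tendsto_const p)
      then have "(\<lambda>k. S (P (X (r k)))) \<longlonglongrightarrow> S (\<Sum>e\<in>F. p e *\<^sub>R e)" by (rule tendsto)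
      moreover have "(\<lambda>k. S (X (r k)) - M *\<^sub>R X (r k)) \<longlonglongrightarrow> 0"
        using LIMSEQ_subseq_LIMSEQ[OF approx r(1)] by (simp add: o_def)
      ultimately have "Z \<longlonglongrightarrow> S (\<Sum>e\<in>F. p e *\<^sub>R e) - 0" unfolding Z_def by (rule tendsto_diff)
      then show ?thesis by (rule convergentI)
    qed
    have X_Z: "M / 2 * norm (X (r k) - X (r l)) \<le> norm (Z k - Z l)" for k l
    proof -
      define d where "d = X (r k) - X (r l)"
      have "Z k - Z l = M *\<^sub>R d - S (d - P d)"
        by (simp add: Z_def d_def P_diff diff add algebra_simps)
      moreover have "norm (M *\<^sub>R d) - norm (S (d - P d)) \<le> norm (M *\<^sub>R d - S (d - P d))"
        by (rule norm_triangle_ineq2)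
      moreover have "norm (S (d - P d)) \<le> M / 2 * norm d"
        using tail[OF P_perp] mult_left_mono[OF P_contr[of d], of "M / 2"] Mpos
        by (meson order_trans less_imp_le half_gt_zero)
      ultimately show ?thesis using Mpos by (simp add: d_def)
    qed
    have "Cauchy (\<lambda>k. X (r k))"
    proof (rule metric_CauchyI)
      fix \<epsilon> :: real assume "0 < \<epsilon>"
      then have "0 < M / 2 * \<epsilon>" using Mpos by simp
      then obtain n0 where "\<forall>k\<ge>n0. \<forall>l\<ge>n0. dist (Z k) (Z l) < M / 2 * \<epsilon>"
        using convergent_Cauchy[OF \<open>convergent Z\<close>] unfolding Cauchy_def by meson
      then have "\<forall>k\<ge>n0. \<forall>l\<ge>n0. M / 2 * dist (X (r k)) (X (r l)) < M / 2 * \<epsilon>"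
        using X_Z unfolding dist_norm by (meson le_less_trans)
      then show "\<exists>n0. \<forall>k\<ge>n0. \<forall>l\<ge>n0. dist (X (r k)) (X (r l)) < \<epsilon>"
        using Mpos by (auto simp: mult_less_cancel_left)
    qed
    then obtain v where v: "(\<lambda>k. X (r k)) \<longlonglongrightarrow> v" using Cauchy_convergent convergent_def by blast
    have "v \<in> V" using V(2) XV v by (metis closed_sequentially)
    moreover have "norm v = 1"
      using tendsto_norm[OF v] X1 by (simp add: LIMSEQ_const_iff)
    moreover have "S v - M *\<^sub>R v = 0"
    proof -
      have "(\<lambda>k. S (X (r k)) - M *\<^sub>R X (r k)) \<longlonglongrightarrow> S v - M *\<^sub>R v"
        by (intro tendsto_intros tendsto v)
      moreover have "(\<lambda>k. S (X (r k)) - M *\<^sub>R X (r k)) \<longlonglongrightarrow> 0"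
        using LIMSEQ_subseq_LIMSEQ[OF approx r(1)] by (simp add: o_def)
      ultimately show ?thesis by (rule LIMSEQ_unique)
    qed
    ultimately show ?thesis using that[of v M] by simp
  qed
qed

text \<open>Zorn gives a maximal orthonormal family of eigenvectors. Its orthogonal complement is
  closed, and invariant by symmetry, so if nonzero it would contain a further eigenvector.\<close>

theorem trace_class_eigenbasis_exists:
  fixes S :: "'x::{real_inner, complete_space} \<Rightarrow> 'x"
  assumes S: "pos_selfadjoint S" and tr: "pos_trace_class S"
  shows "\<exists>E. orthonormal_basis E \<and> (\<forall>e\<in>E. \<exists>\<sigma>. S e = \<sigma> *\<^sub>R e)"
proof -
  interpret bounded_linear S by (rule pos_selfadjoint_bounded_linear[OF S])
  define \<A> where "\<A> = {E. orthonormal E \<and> (\<forall>e\<in>E. \<exists>\<sigma>. S e = \<sigma> *\<^sub>R e)}"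
  have "\<exists>E\<in>\<A>. \<forall>X\<in>\<A>. E \<subseteq> X \<longrightarrow> X = E"
  proof (rule subset_Zorn')
    fix \<C> assume chain: "subset.chain \<A> \<C>"
    have "orthogonal e f" if "e \<in> \<Union>\<C>" "f \<in> \<Union>\<C>" "e \<noteq> f" for e f
    proof -
      obtain E F where EF: "E \<in> \<C>" "e \<in> E" "F \<in> \<C>" "f \<in> F" using \<open>e \<in> \<Union>\<C>\<close> \<open>f \<in> \<Union>\<C>\<close> by blast
      then have "E \<subseteq> F \<or> F \<subseteq> E" using chain unfolding subset_chain_def by blast
      then have "E \<union> F \<in> \<C>" using EF by (auto simp: sup_absorb1 sup_absorb2)
      then have "orthonormal (E \<union> F)" using chain by (auto simp: subset_chain_def \<A>_def)
      then show ?thesis using EF that by (auto simp: orthonormal_def pairwise_def)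
    qed
    then have "pairwise orthogonal (\<Union>\<C>)" unfolding pairwise_def by blast
    moreover have "norm e = 1 \<and> (\<exists>\<sigma>. S e = \<sigma> *\<^sub>R e)" if "e \<in> \<Union>\<C>" for e
      using chain that unfolding subset_chain_def \<A>_def orthonormal_def by blast
    ultimately show "\<Union>\<C> \<in> \<A>" unfolding \<A>_def orthonormal_def by blast
  qed
  then obtain E where E: "E \<in> \<A>" and max: "\<And>X. X \<in> \<A> \<Longrightarrow> E \<subseteq> X \<Longrightarrow> X = E" by metis
  have on: "orthonormal E" using E by (simp add: \<A>_def)
  have "orthonormal_basis E"
  proof (rule orthonormal_basisI[OF on], rule ccontr)
    fix x assume x: "\<And>e. e \<in> E \<Longrightarrow> x \<bullet> e = 0" and "x \<noteq> 0"
    define V where "V = {v. \<forall>e\<in>E. v \<bullet> e = 0}"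
    have "V = (\<Inter>e\<in>E. {v. v \<bullet> e = 0})" by (auto simp: V_def)
    then have "closed V" by (auto intro!: closed_INT closed_Collect_eq continuous_intros)
    moreover have "subspace V" by (auto simp: V_def subspace_def inner_add_left)
    moreover have "S v \<in> V" if "v \<in> V" for v
    proof -
      have "S v \<bullet> e = 0" if "e \<in> E" for e
      proof -
        obtain \<sigma> where "S e = \<sigma> *\<^sub>R e" using E \<open>e \<in> E\<close> by (auto simp: \<A>_def)
        then show ?thesis
          using pos_selfadjoint_sym[OF S, of v e] \<open>v \<in> V\<close> \<open>e \<in> E\<close> by (simp add: V_def)
      qed
      then show ?thesis by (simp add: V_def)
    qed
    moreover have "x \<in> V" using x by (simp add: V_def)
    ultimately obtain v \<mu> where v: "v \<in> V" "norm v = 1" "S v = \<mu> *\<^sub>R v"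
      using trace_class_eigenvector[OF S tr] \<open>x \<noteq> 0\<close> by metis
    have "insert v E \<in> \<A>"
      using E v by (auto simp: \<A>_def orthonormal_def pairwise_insert V_def orthogonal_def inner_commute)
    then have "v \<in> E" using max[of "insert v E"] by auto
    then show False using v(1,2) dot_square_norm[of v] by (auto simp: V_def)
  qed
  then show ?thesis using E by (auto simp: \<A>_def)
qed

lemma
  fixes S :: "'x::{real_inner, complete_space} \<Rightarrow> 'x"
  assumes S: "pos_selfadjoint S" and tr: "pos_trace_class S"
  shows orthonormal_basis_eigenbasis: "orthonormal_basis (eigenbasis S)"
    and eigenbasis_eigenvector: "e \<in> eigenbasis S \<Longrightarrow> S e = (S e \<bullet> e) *\<^sub>R e"
proof -
  have H: "orthonormal_basis (eigenbasis S) \<and> (\<forall>e\<in>eigenbasis S. \<exists>\<sigma>. S e = \<sigma> *\<^sub>R e)"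
    unfolding eigenbasis_def by (rule someI_ex[OF trace_class_eigenbasis_exists[OF S tr]])
  then show "orthonormal_basis (eigenbasis S)" by blast
  assume e: "e \<in> eigenbasis S"
  then obtain \<sigma> where \<sigma>: "S e = \<sigma> *\<^sub>R e" using H by blast
  moreover have "e \<bullet> e = 1" using H e by (simp add: orthonormal_basis_def dot_square_norm)
  ultimately show "S e = (S e \<bullet> e) *\<^sub>R e" by simp
qed

section \<open>Bias in a Hilbert scale\<close>

lemma has_sum_sum:
  fixes f :: "'i \<Rightarrow> 'a \<Rightarrow> 'b::topological_comm_monoid_add"
  assumes "\<And>i. i \<in> I \<Longrightarrow> (f i has_sum s i) A"
  shows "((\<lambda>x. \<Sum>i\<in>I. f i x) has_sum (\<Sum>i\<in>I. s i)) A"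
  using assms by (induction I rule: infinite_finite_induct) (auto intro!: has_sum_add)

lemma powr_mult_square: "(b powr p * y)\<^sup>2 = b powr (2 * p) * y\<^sup>2" for b p y :: real
  by (simp only: power_mult_distrib power2_eq_square[of "b powr p"] powr_add[symmetric] mult_2)

lemma eigenbasis_inner:
  fixes S :: "'x::{real_inner, complete_space} \<Rightarrow> 'x"
  assumes S: "pos_selfadjoint S" and tr: "pos_trace_class S" and e: "e \<in> eigenbasis S"
  shows "S x \<bullet> e = (S e \<bullet> e) * (x \<bullet> e)"
proof -
  have "S x \<bullet> e = x \<bullet> S e" by (rule pos_selfadjoint_sym[OF S])
  also have "\<dots> = (S e \<bullet> e) * (x \<bullet> e)"
    by (subst eigenbasis_eigenvector[OF S tr e]) simp
  finally show ?thesis .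
qed

lemma eigenbasis_form:
  fixes S :: "'x::{real_inner, complete_space} \<Rightarrow> 'x"
  assumes S: "pos_selfadjoint S" and tr: "pos_trace_class S"
  shows "((\<lambda>e. (S e \<bullet> e) * (x \<bullet> e)\<^sup>2) has_sum S x \<bullet> x) (eigenbasis S)"
  by (rule has_sum_cong[THEN iffD1, OF _ parseval_inner[OF orthonormal_basis_eigenbasis[OF S tr]]])
     (simp add: eigenbasis_inner[OF S tr, where x = x] inner_commute[of _ x] power2_eq_square)

text \<open>Trace class controls the sum over a single basis \<open>E\<close>. Expanding the
  eigenvectors in \<open>E\<close> and exchanging sums transfers the bound, since finite sums of
  \<open>(S h \<bullet> h) * (h \<bullet> e)^2\<close> over \<open>h\<close> stay below
  \<open>S e \<bullet> e\<close>.\<close>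

lemma eigenvalues_summable:
  fixes S :: "'x::{real_inner, complete_space} \<Rightarrow> 'x"
  assumes S: "pos_selfadjoint S" and tr: "pos_trace_class S"
  shows "(\<lambda>e. S e \<bullet> e) summable_on eigenbasis S"
proof -
  obtain E where E: "orthonormal_basis E" and sum_E: "(\<lambda>e. S e \<bullet> e) summable_on E"
    using tr by (auto simp: pos_trace_class_def)
  note H = orthonormal_basis_eigenbasis[OF S tr]
  have "(\<Sum>h\<in>G. S h \<bullet> h) \<le> (\<Sum>\<^sub>\<infinity>e\<in>E. S e \<bullet> e)" if G: "finite G" "G \<subseteq> eigenbasis S" for G
  proof (rule has_sum_mono)
    show "((\<lambda>e. S e \<bullet> e) has_sum (\<Sum>\<^sub>\<infinity>e\<in>E. S e \<bullet> e)) E" using sum_E by simp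
    have "((\<lambda>e. \<Sum>h\<in>G. (S h \<bullet> h) * (h \<bullet> e)\<^sup>2) has_sum (\<Sum>h\<in>G. (S h \<bullet> h) * (norm h)\<^sup>2)) E"
      by (intro has_sum_sum has_sum_cmult_right parseval[OF E])
    moreover have "(\<Sum>h\<in>G. (S h \<bullet> h) * (norm h)\<^sup>2) = (\<Sum>h\<in>G. S h \<bullet> h)"
      using G(2) H by (intro sum.cong) (auto simp: orthonormal_basis_def)
    ultimately show "((\<lambda>e. \<Sum>h\<in>G. (S h \<bullet> h) * (h \<bullet> e)\<^sup>2) has_sum (\<Sum>h\<in>G. S h \<bullet> h)) E" by simp
    show "(\<Sum>h\<in>G. (S h \<bullet> h) * (h \<bullet> e)\<^sup>2) \<le> S e \<bullet> e" for e
      using finite_sum_le_has_sum[OF eigenbasis_form[OF S tr, of e] G]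
      by (simp add: pos_selfadjoint_nonneg[OF S] inner_commute[of e])
  qed
  then show ?thesis
    by (intro nonneg_bounded_partial_sums_imp_summable_on eventually_finite_subsets_at_top_weakI)
       (auto simp: pos_selfadjoint_nonneg[OF S])
qed

text \<open>The same double sum read backwards, from the eigenbasis to any orthonormal family, with
  Bessel in place of Parseval. It ensures that the sum in \<open>op_trace\<close> converges for
  whatever basis is chosen there.\<close>

lemma trace_class_summable:
  fixes S :: "'x::{real_inner, complete_space} \<Rightarrow> 'x"
  assumes S: "pos_selfadjoint S" and tr: "pos_trace_class S" and E: "orthonormal E"
  shows "(\<lambda>e. S e \<bullet> e) summable_on E"
proof -
  note H = orthonormal_basis_eigenbasis[OF S tr]
  have "(\<Sum>f\<in>F. S f \<bullet> f) \<le> (\<Sum>\<^sub>\<infinity>h\<in>eigenbasis S. S h \<bullet> h)" if F: "finite F" "F \<subseteq> E" for F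
  proof (rule has_sum_mono)
    show "((\<lambda>h. S h \<bullet> h) has_sum (\<Sum>\<^sub>\<infinity>h\<in>eigenbasis S. S h \<bullet> h)) (eigenbasis S)"
      using eigenvalues_summable[OF S tr] by simp
    show "((\<lambda>h. \<Sum>f\<in>F. (S h \<bullet> h) * (f \<bullet> h)\<^sup>2) has_sum (\<Sum>f\<in>F. S f \<bullet> f)) (eigenbasis S)"
      by (intro has_sum_sum eigenbasis_form[OF S tr])
    show "(\<Sum>f\<in>F. (S h \<bullet> h) * (f \<bullet> h)\<^sup>2) \<le> S h \<bullet> h" if "h \<in> eigenbasis S" for h
    proof -
      have "(\<Sum>f\<in>F. (h \<bullet> f)\<^sup>2) \<le> (norm h)\<^sup>2" by (rule bessel_inequality[OF E F])
      also have "\<dots> = 1" using H that by (simp add: orthonormal_basis_def)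
      finally show ?thesis
        using mult_left_mono[OF _ pos_selfadjoint_nonneg[OF S, of h]]
        by (fastforce simp: inner_commute[of _ h] simp flip: sum_distrib_left)
    qed
  qed
  then show ?thesis
    by (intro nonneg_bounded_partial_sums_imp_summable_on eventually_finite_subsets_at_top_weakI)
       (auto simp: pos_selfadjoint_nonneg[OF S])
qed

text \<open>For nonnegative \<open>p\<close> the weights are at most \<open>K powr (2 * p)\<close>,
  so the series converges for every \<open>x\<close> and \<open>op_powr\<close> is not the default 0
  of a divergent \<open>infsum\<close>.\<close>

lemma op_powr_norm:
  fixes S :: "'x::{real_inner, complete_space} \<Rightarrow> 'x"
  assumes S: "pos_selfadjoint S" and tr: "pos_trace_class S" and p: "0 \<le> p"
  shows "((\<lambda>e. (S e \<bullet> e) powr (2 * p) * (x \<bullet> e)\<^sup>2) has_sum (norm (op_powr S p x))\<^sup>2) (eigenbasis S)"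
proof -
  let ?H = "eigenbasis S"
  have H: "orthonormal_basis ?H" and on: "orthonormal ?H"
    using orthonormal_basis_eigenbasis[OF S tr] by (auto simp: orthonormal_basis_iff)
  note sq = powr_mult_square
  obtain K where K: "K > 0" "\<And>x. S x \<bullet> x \<le> K * (norm x)\<^sup>2"
    using pos_selfadjoint_form_bound[OF S] by metis
  have "(\<lambda>e. ((S e \<bullet> e) powr p * (x \<bullet> e))\<^sup>2) summable_on ?H"
  proof (rule summable_on_comparison_test)
    show "(\<lambda>e. K powr (2 * p) * (x \<bullet> e)\<^sup>2) summable_on ?H"
      by (intro summable_on_cmult_right bessel_summable[OF on])
    show "((S e \<bullet> e) powr p * (x \<bullet> e))\<^sup>2 \<le> K powr (2 * p) * (x \<bullet> e)\<^sup>2" if "e \<in> ?H" for e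
    proof -
      have "S e \<bullet> e \<le> K" using K(2)[of e] on that by (simp add: orthonormal_def)
      then show ?thesis
        unfolding sq using p by (intro mult_right_mono powr_mono2 pos_selfadjoint_nonneg[OF S]) auto
    qed
  qed auto
  then have "(\<lambda>e. ((S e \<bullet> e) powr p * (x \<bullet> e)) *\<^sub>R e) summable_on ?H"
    by (rule orthonormal_summable[OF on])
  then have "((\<lambda>e. ((S e \<bullet> e) powr p * (x \<bullet> e)) *\<^sub>R e) has_sum op_powr S p x) ?H"
    unfolding op_powr_def by simp
  from orthonormal_has_sum_norm[OF on this] show ?thesis by (simp only: sq)
qed

section \<open>The norm of \<open>A x\<close> against a power of the prior covariance\<close>

locale hilbert_scale_link =
  fixes A :: "'x::{real_inner, complete_space} \<Rightarrow> 'y::real_inner"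
    and S :: "'x \<Rightarrow> 'x" and a c :: real
  assumes A: "bounded_linear A"
    and S: "pos_selfadjoint S" and inj: "inj S" and trace_class: "pos_trace_class S"
    and a: "0 < a" and c: "1 \<le> c"
    and lower: "inverse c * norm (op_powr S (a / 2) x) \<le> norm (A x)"
    and upper: "norm (A x) \<le> c * norm (op_powr S (a / 2) x)"
begin

sublocale S: bounded_linear S by (rule pos_selfadjoint_bounded_linear[OF S])
sublocale A: bounded_linear A by (rule A)

abbreviation "H \<equiv> eigenbasis S"
abbreviation "\<sigma> e \<equiv> S e \<bullet> e"

lemmas basis_H = orthonormal_basis_eigenbasis[OF S trace_class]

lemma orthonormal_H: "orthonormal H"
  using basis_H by (simp add: orthonormal_basis_iff)

lemma adjoint_A: "A x \<bullet> y = x \<bullet> adjoint A y"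
  by (rule adjoint_works_hilbert[OF basis_H A])

text \<open>If the form vanishes at \<open>x\<close>, Cauchy-Schwarz with \<open>S x\<close> makes
  \<open>S x\<close> vanish, and injectivity then makes \<open>x\<close> vanish.\<close>

lemma form_pos: "x \<noteq> 0 \<Longrightarrow> 0 < S x \<bullet> x"
proof (rule ccontr)
  assume x: "x \<noteq> 0" and "\<not> 0 < S x \<bullet> x"
  have "S x \<bullet> x = 0" using pos_selfadjoint_nonneg[OF S, of x] \<open>\<not> 0 < S x \<bullet> x\<close> by simp
  then have "(S x \<bullet> S x)\<^sup>2 \<le> 0"
    using pos_selfadjoint_cauchy_schwarz[OF S, of x "S x"] by simp
  then have "S x = S 0" by (simp add: S.zero)
  then show False using injD[OF inj] x by blast
qed

lemma eigenvalue_pos: "e \<in> H \<Longrightarrow> 0 < \<sigma> e"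
  using orthonormal_H by (intro form_pos) (auto simp: orthonormal_def)

lemma scale_norm: "((\<lambda>e. \<sigma> e powr a * (x \<bullet> e)\<^sup>2) has_sum (norm (op_powr S (a / 2) x))\<^sup>2) H"
  using op_powr_norm[OF S trace_class, of "a / 2" x] a by simp

lemma scale_norm_le: "(norm (op_powr S (a / 2) x))\<^sup>2 \<le> c\<^sup>2 * (norm (A x))\<^sup>2"
proof -
  have "norm (op_powr S (a / 2) x) \<le> c * norm (A x)"
    using lower[of x] c by (simp add: field_simps)
  then have "(norm (op_powr S (a / 2) x))\<^sup>2 \<le> (c * norm (A x))\<^sup>2" by (rule power_mono) simp
  then show ?thesis by (simp add: power_mult_distrib)
qed

text \<open>Replaces interpolation between the norms of \<open>\<Sigma>\<^sup>a\<^sup>/\<^sup>2 v\<close> and \<open>\<Sigma>\<^sup>-\<^sup>1\<^sup>/\<^sup>2 v\<close> for \<open>v = \<Sigma> z\<close>: the factor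
  \<open>(\<sigma> / l)\<^sup>a + l / \<sigma>\<close> is at least 1 for every eigenvalue \<open>\<sigma>\<close>.\<close>

lemma additive_interpolation:
  assumes l: "0 < l"
  shows "(norm (S z))\<^sup>2 \<le> l powr (- a) * c\<^sup>2 * (norm (A (S z)))\<^sup>2 + l * (S z \<bullet> z)"
proof -
  have "(norm (S z))\<^sup>2 \<le> l powr (- a) * (norm (op_powr S (a / 2) (S z)))\<^sup>2 + l * (S z \<bullet> z)"
  proof (rule has_sum_mono)
    show "((\<lambda>e. (S z \<bullet> e)\<^sup>2) has_sum (norm (S z))\<^sup>2) H" by (rule parseval[OF basis_H])
    show "((\<lambda>e. l powr (- a) * (\<sigma> e powr a * (S z \<bullet> e)\<^sup>2) + l * (\<sigma> e * (z \<bullet> e)\<^sup>2)) has_sum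
        l powr (- a) * (norm (op_powr S (a / 2) (S z)))\<^sup>2 + l * (S z \<bullet> z)) H"
      by (intro has_sum_add has_sum_cmult_right scale_norm eigenbasis_form[OF S trace_class])
    fix e assume e: "e \<in> H"
    note pos = eigenvalue_pos[OF e]
    show "(S z \<bullet> e)\<^sup>2 \<le> l powr (- a) * (\<sigma> e powr a * (S z \<bullet> e)\<^sup>2) + l * (\<sigma> e * (z \<bullet> e)\<^sup>2)"
    proof (cases "l \<le> \<sigma> e")
      case True
      then have "1 \<le> l powr (- a) * \<sigma> e powr a"
        using l a powr_mono2[of a l "\<sigma> e"] by (simp add: powr_minus field_simps)
      then have "1 * (S z \<bullet> e)\<^sup>2 \<le> (l powr (- a) * \<sigma> e powr a) * (S z \<bullet> e)\<^sup>2"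
        by (rule mult_right_mono) simp
      moreover have "0 \<le> l * (\<sigma> e * (z \<bullet> e)\<^sup>2)" using l pos by simp
      ultimately show ?thesis by (simp add: mult.assoc)
    next
      case False
      then have "\<sigma> e * (\<sigma> e * (z \<bullet> e)\<^sup>2) \<le> l * (\<sigma> e * (z \<bullet> e)\<^sup>2)"
        using pos by (intro mult_right_mono) auto
      moreover have "0 \<le> l powr (- a) * (\<sigma> e powr a * (S z \<bullet> e)\<^sup>2)" by simp
      moreover have "(S z \<bullet> e)\<^sup>2 = \<sigma> e * (\<sigma> e * (z \<bullet> e)\<^sup>2)"
        unfolding eigenbasis_inner[OF S trace_class e, where x = z] by (simp add: power2_eq_square mult_ac)
      ultimately show ?thesis by linarith
    qed
  qed
  also have "\<dots> \<le> l powr (- a) * (c\<^sup>2 * (norm (A (S z)))\<^sup>2) + l * (S z \<bullet> z)"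
    by (intro add_right_mono mult_left_mono scale_norm_le) simp
  finally show ?thesis by (simp add: mult.assoc)
qed

text \<open>Both lemmas test the equation \<open>\<Sigma>\<^sup>-\<^sup>1v + t A\<^sup>*A v = g\<close> with \<open>v = \<Sigma> z\<close> itself. Above the cutoff, \<open>v\<close> is
  the residual for the data \<open>\<Sigma> g\<close>; below it, \<open>v\<close> is the difference between the data \<open>w\<close> and their residual.\<close>

lemma bias_above_cutoff:
  assumes l: "0 < l" and t: "t = l powr (- (a + 1))"
    and z: "z + t *\<^sub>R adjoint A (A (S z)) = g"
    and g: "(g \<bullet> S z)\<^sup>2 \<le> G * (norm (op_powr S (a / 2) (S z)))\<^sup>2" and G: "0 \<le> G"
  shows "(norm (S z))\<^sup>2 \<le> (c\<^sup>2 + 1) * c\<^sup>2 * l powr (a + 2) * G"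
proof -
  define P Y k where "P = S z \<bullet> z" and "Y = (norm (A (S z)))\<^sup>2" and "k = c\<^sup>2 * G"
  have t0: "0 < t" using t l by simp
  have P0: "0 \<le> P" unfolding P_def by (rule pos_selfadjoint_nonneg[OF S])
  have Y0: "0 \<le> Y" and k0: "0 \<le> k" using G by (auto simp: Y_def k_def)
  have energy: "P + t * Y = g \<bullet> S z"
    unfolding z[symmetric] P_def Y_def inner_add_left inner_scaleR_left power2_norm_eq_inner
      inner_commute[of "adjoint A (A (S z))"] inner_commute[of z] adjoint_A[symmetric] ..
  have "(P + t * Y)\<^sup>2 \<le> G * (c\<^sup>2 * Y)"
    using order_trans[OF g mult_left_mono[OF scale_norm_le G]] unfolding Y_def energy[unfolded Y_def] .
  then have main: "(P + t * Y)\<^sup>2 \<le> k * Y" by (simp add: k_def mult_ac)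
  \<comment> \<open>Dropping \<open>P^2\<close> from the expanded square leaves a common factor
    \<open>Y\<close>; once it is cancelled, both energies are linear in \<open>k\<close>. For
    \<open>Y = 0\<close>, \<open>main\<close> forces \<open>P = 0\<close>.\<close>
  have bounds: "t * (t * Y) \<le> k \<and> t * P \<le> k"
  proof (cases "Y = 0")
    case True
    then show ?thesis using main k0 by simp
  next
    case False
    then have Y: "0 < Y" using Y0 by simp
    have "t * (t * Y) * Y + 2 * (t * P) * Y \<le> (P + t * Y)\<^sup>2"
      by (simp add: power2_eq_square algebra_simps)
    then have "(t * (t * Y) + 2 * (t * P)) * Y \<le> k * Y" using main by (simp add: algebra_simps)
    then have "t * (t * Y) + 2 * (t * P) \<le> k" using Y by simp
    moreover have "0 \<le> t * P" "0 \<le> t * (t * Y)" using t0 P0 Y0 by auto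
    ultimately show ?thesis by linarith
  qed
  have inv_t: "inverse t = l powr (a + 1)" by (simp only: t powr_minus inverse_inverse_eq)
  have "Y \<le> inverse t * inverse t * k" "P \<le> inverse t * k"
    using bounds t0 by (auto simp: field_simps)
  \<comment> \<open>With \<open>inverse t = l powr (a + 1)\<close> both terms of the interpolation
    bound scale like \<open>l powr (a + 2)\<close>; this balance dictates the relation between
    \<open>l\<close> and \<open>t\<close>.\<close>
  then have "l powr (- a) * c\<^sup>2 * Y + l * P
      \<le> l powr (- a) * c\<^sup>2 * (inverse t * inverse t * k) + l * (inverse t * k)"
    using l by (intro add_mono mult_left_mono) auto
  also have "\<dots> = (l powr (- a) * (l powr (a + 1) * l powr (a + 1))) * c\<^sup>2 * k
      + (l powr 1 * l powr (a + 1)) * k"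
    using l by (simp add: inv_t mult_ac)
  also have "\<dots> = (c\<^sup>2 + 1) * l powr (a + 2) * k"
    by (simp only: flip: powr_add) (simp add: algebra_simps)
  finally show ?thesis
    using additive_interpolation[OF l, of z] by (simp add: P_def Y_def k_def mult_ac)
qed

lemma bias_below_cutoff:
  assumes l: "0 < l" and t: "t = l powr (- (a + 1))"
    and z: "z + t *\<^sub>R adjoint A (A (S z)) = t *\<^sub>R adjoint A (A w)"
  shows "(norm (S z))\<^sup>2 \<le> (c\<^sup>2 + 1) * c\<^sup>2 * l powr (- a) * (norm (op_powr S (a / 2) w))\<^sup>2"
proof -
  define P Y where "P = S z \<bullet> z" and "Y = norm (A (S z))"
  have t0: "0 < t" using t l by simp
  have P0: "0 \<le> P" unfolding P_def by (rule pos_selfadjoint_nonneg[OF S])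
  have "P + t * Y\<^sup>2 = S z \<bullet> (z + t *\<^sub>R adjoint A (A (S z)))"
    by (simp add: P_def Y_def inner_add_right power2_norm_eq_inner flip: adjoint_A)
  also have "\<dots> = t * (A (S z) \<bullet> A w)"
    unfolding z by (simp flip: adjoint_A)
  also have "\<dots> \<le> t * (Y * norm (A w))"
    unfolding Y_def using t0 by (intro mult_left_mono norm_cauchy_schwarz) auto
  finally have main: "P + t * Y\<^sup>2 \<le> t * (Y * norm (A w))" .
  \<comment> \<open>Dropping \<open>P\<close> from \<open>main\<close> bounds \<open>Y\<close> by
    \<open>norm (A w)\<close>; dropping \<open>t * Y^2\<close> then bounds \<open>P\<close>.\<close>
  then have "t * (Y * Y) \<le> t * (Y * norm (A w))" using P0 by (simp add: power2_eq_square)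
  then have "Y * Y \<le> Y * norm (A w)" using t0 by simp
  then have Y: "Y \<le> norm (A w)" by (cases "Y = 0") (auto simp: Y_def)
  then have "Y * norm (A w) \<le> norm (A w) * norm (A w)" by (intro mult_right_mono) auto
  then have "t * (Y * norm (A w)) \<le> t * (norm (A w))\<^sup>2"
    using t0 by (simp add: power2_eq_square)
  moreover have "0 \<le> t * Y\<^sup>2" using t0 by simp
  ultimately have P: "P \<le> t * (norm (A w))\<^sup>2" using main by linarith
  have Y2: "Y\<^sup>2 \<le> (norm (A w))\<^sup>2" using Y by (intro power_mono) (auto simp: Y_def)
  have lt: "l * t = l powr (- a)"
    using l powr_add[of l 1 "- (a + 1)"] by (simp add: t)
  have "l powr (- a) * c\<^sup>2 * Y\<^sup>2 + l * P
      \<le> l powr (- a) * c\<^sup>2 * (norm (A w))\<^sup>2 + l * (t * (norm (A w))\<^sup>2)"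
    using l P Y2 by (intro add_mono mult_left_mono) auto
  also have "\<dots> = (c\<^sup>2 + 1) * l powr (- a) * (norm (A w))\<^sup>2"
    by (simp add: mult.assoc[symmetric] lt) (simp add: algebra_simps)
  also have "\<dots> \<le> (c\<^sup>2 + 1) * l powr (- a) * (c * norm (op_powr S (a / 2) w))\<^sup>2"
    by (intro mult_left_mono power_mono upper) auto
  finally show ?thesis
    using additive_interpolation[OF l, of z] by (simp add: P_def Y_def power_mult_distrib mult_ac)
qed

text \<open>\<open>W\<close> is the squared norm of \<open>S^(-s/2) x\<close>. The vectors
  \<open>r (S g)\<close>, \<open>w\<close> and \<open>w - r w\<close> each have squared norm of
  order \<open>l powr s * W\<close>; the 3 comes from squaring a sum of three terms, the two copies
  of \<open>(c^2 + 1) * c^2\<close> from the cutoff lemmas.\<close>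

lemma bias_bound:
  assumes t: "0 < t" and r: "linear r" "\<And>x. r x + t *\<^sub>R S (adjoint A (A (r x))) = x"
    and s: "0 \<le> s" "s \<le> a + 2"
    and W: "((\<lambda>e. \<sigma> e powr (- s) * (x \<bullet> e)\<^sup>2) has_sum W) H"
  shows "(norm (r x))\<^sup>2 \<le> 3 * (2 * ((c\<^sup>2 + 1) * c\<^sup>2) + 1) * W * t powr (- (s / (a + 1)))"
proof -
  define l where "l = t powr (- (1 / (a + 1)))"
  have l: "0 < l" using t by (simp add: l_def)
  have tl: "t = l powr (- (a + 1))" 
  proof -
    have "- (1 / (a + 1)) * - (a + 1) = 1" using a by (simp add: field_simps)
    then have "t powr (- (1 / (a + 1)) * - (a + 1)) = t" using t by simp
    then show ?thesis by (simp only: l_def powr_powr)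
  qed
  have ls: "l powr s = t powr (- (s / (a + 1)))" using t by (simp add: l_def powr_powr)
  define L where "L = {e \<in> H. l \<le> \<sigma> e}"
  \<comment> \<open>Summable eigenvalues exceed a positive level only finitely often, so the part of
    \<open>x\<close> above the cutoff has an exact preimage under \<open>S\<close>, namely the
    finite sum \<open>g\<close>.\<close>
  have finL: "finite L"
  proof (rule ccontr)
    assume "infinite L"
    have "(\<lambda>e. \<sigma> e) summable_on L"
      by (rule summable_on_subset_banach[OF eigenvalues_summable[OF S trace_class]]) (auto simp: L_def)
    then have "(\<lambda>e. l) summable_on L"
      by (rule summable_on_comparison_test) (use l in \<open>auto simp: L_def\<close>)
    with infsum_diverge_constant[OF \<open>infinite L\<close>, of l] l show False by simp
  qed
  have LH: "L \<subseteq> H" by (auto simp: L_def)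
  define g where "g = (\<Sum>e\<in>L. ((x \<bullet> e) / \<sigma> e) *\<^sub>R e)"
  define w where "w = x - S g"
  have Sg: "S g \<bullet> e = (if e \<in> L then x \<bullet> e else 0)" if "e \<in> H" for e
    using eigenbasis_inner[OF S trace_class that, of g] eigenvalue_pos[OF that]
      inner_sum_orthonormal[OF orthonormal_H finL LH that, of "\<lambda>e. (x \<bullet> e) / \<sigma> e"]
    by (auto simp: g_def)
  have w: "w \<bullet> e = (if e \<in> L then 0 else x \<bullet> e)" if "e \<in> H" for e
    using Sg[OF that] by (simp add: w_def inner_diff_left)
  have W0: "0 \<le> W" by (rule has_sum_nonneg[OF W]) simp

  have above: "(norm (r (S g)))\<^sup>2 \<le> (c\<^sup>2 + 1) * c\<^sup>2 * l powr s * W"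
  proof -
    define z where "z = g - t *\<^sub>R adjoint A (A (r (S g)))"
    have rz: "r (S g) = S z"
      using r(2)[of "S g"] by (simp add: z_def S.diff S.scaleR algebra_simps)
    \<comment> \<open>Splitting \<open>1 / \<sigma>\<close> as
      \<open>\<sigma>^(-1-a/2) * \<sigma>^(a/2)\<close> before Cauchy-Schwarz produces the scale
      norm of \<open>S z\<close>; the other factor serves as \<open>G\<close> in
      \<open>bias_above_cutoff\<close>.\<close>
    have "(g \<bullet> S z)\<^sup>2 \<le> (\<Sum>e\<in>L. \<sigma> e powr (- 2 - a) * (x \<bullet> e)\<^sup>2) * (norm (op_powr S (a / 2) (S z)))\<^sup>2"
    proof -
      have "(g \<bullet> S z)\<^sup>2 = (\<Sum>e\<in>L. (\<sigma> e powr (- 1 - a / 2) * (x \<bullet> e)) * (\<sigma> e powr (a / 2) * (S z \<bullet> e)))\<^sup>2"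
      proof -
        have "(x \<bullet> e) / \<sigma> e * (e \<bullet> S z)
            = (\<sigma> e powr (- 1 - a / 2) * (x \<bullet> e)) * (\<sigma> e powr (a / 2) * (S z \<bullet> e))" if "e \<in> L" for e
        proof -
          have pos: "0 < \<sigma> e" using that LH eigenvalue_pos by blast
          have "\<sigma> e powr (- 1 - a / 2) * \<sigma> e powr (a / 2) = \<sigma> e powr (- 1)"
            by (simp only: powr_add[symmetric]) simp
          also have "\<dots> = 1 / \<sigma> e" using pos by (rule powr_neg_one)
          finally have p: "\<sigma> e powr (- 1 - a / 2) * \<sigma> e powr (a / 2) = 1 / \<sigma> e" .
          have "(\<sigma> e powr (- 1 - a / 2) * (x \<bullet> e)) * (\<sigma> e powr (a / 2) * (S z \<bullet> e))
              = (\<sigma> e powr (- 1 - a / 2) * \<sigma> e powr (a / 2)) * ((x \<bullet> e) * (S z \<bullet> e))"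
            by (simp only: mult_ac)
          then show ?thesis unfolding p by (simp add: inner_commute[of e])
        qed
        then show ?thesis
          unfolding g_def inner_sum_left inner_scaleR_left by (metis (no_types, lifting) sum.cong)
      qed
      also have "\<dots> \<le> (\<Sum>e\<in>L. (\<sigma> e powr (- 1 - a / 2) * (x \<bullet> e))\<^sup>2)
          * (\<Sum>e\<in>L. (\<sigma> e powr (a / 2) * (S z \<bullet> e))\<^sup>2)"
        by (rule Cauchy_Schwarz_ineq_sum)
      also have "\<dots> = (\<Sum>e\<in>L. \<sigma> e powr (- 2 - a) * (x \<bullet> e)\<^sup>2) * (\<Sum>e\<in>L. \<sigma> e powr a * (S z \<bullet> e)\<^sup>2)"
        by (simp add: powr_mult_square)
      also have "\<dots> \<le> (\<Sum>e\<in>L. \<sigma> e powr (- 2 - a) * (x \<bullet> e)\<^sup>2) * (norm (op_powr S (a / 2) (S z)))\<^sup>2"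
        by (intro mult_left_mono finite_sum_le_has_sum[OF scale_norm finL LH] sum_nonneg) auto
      finally show ?thesis .
    qed
    then have "(norm (S z))\<^sup>2
        \<le> (c\<^sup>2 + 1) * c\<^sup>2 * l powr (a + 2) * (\<Sum>e\<in>L. \<sigma> e powr (- 2 - a) * (x \<bullet> e)\<^sup>2)"
    proof (intro bias_above_cutoff[OF l tl])
      show "z + t *\<^sub>R adjoint A (A (S z)) = g" unfolding rz[symmetric] by (simp add: z_def)
    qed (auto intro!: sum_nonneg)
    also have "\<dots> \<le> (c\<^sup>2 + 1) * c\<^sup>2 * l powr (a + 2) * (l powr (s - a - 2) * W)"
    proof (intro mult_left_mono)
      have "(\<Sum>e\<in>L. \<sigma> e powr (- 2 - a) * (x \<bullet> e)\<^sup>2)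
          \<le> (\<Sum>e\<in>L. l powr (s - a - 2) * (\<sigma> e powr (- s) * (x \<bullet> e)\<^sup>2))"
      proof (rule sum_mono)
        fix e assume e: "e \<in> L"
        have "\<sigma> e powr (- 2 - a) = \<sigma> e powr (s - a - 2) * \<sigma> e powr (- s)"
          by (simp only: powr_add[symmetric]) (rule arg_cong[where f = "\<lambda>q. \<sigma> e powr q"], simp)
        \<comment> \<open>Here \<open>s \<le> a + 2\<close> enters: the exponent is nonpositive, so
          the power is largest at the cutoff.\<close>
        also have "\<dots> \<le> l powr (s - a - 2) * \<sigma> e powr (- s)"
          using e l s by (intro mult_right_mono powr_mono2') (auto simp: L_def)
        finally show "\<sigma> e powr (- 2 - a) * (x \<bullet> e)\<^sup>2 \<le> l powr (s - a - 2) * (\<sigma> e powr (- s) * (x \<bullet> e)\<^sup>2)"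
          by (simp only: mult.assoc[symmetric]) (rule mult_right_mono, simp_all)
      qed
      also have "\<dots> \<le> l powr (s - a - 2) * W"
        unfolding sum_distrib_left[symmetric]
        by (intro mult_left_mono finite_sum_le_has_sum[OF W finL LH]) auto
      finally show "(\<Sum>e\<in>L. \<sigma> e powr (- 2 - a) * (x \<bullet> e)\<^sup>2) \<le> l powr (s - a - 2) * W" .
    qed auto
    also have "\<dots> = (c\<^sup>2 + 1) * c\<^sup>2 * (l powr (a + 2) * l powr (s - a - 2)) * W"
      by (simp only: mult_ac)
    also have "\<dots> = (c\<^sup>2 + 1) * c\<^sup>2 * l powr s * W"
      by (simp only: flip: powr_add) simp
    finally show ?thesis by (simp add: rz)
  qed

  have w_norm: "(norm w)\<^sup>2 \<le> l powr s * W"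
  proof (rule has_sum_mono[OF parseval[OF basis_H] has_sum_cmult_right[OF W]])
    fix e assume e: "e \<in> H"
    show "(w \<bullet> e)\<^sup>2 \<le> l powr s * (\<sigma> e powr (- s) * (x \<bullet> e)\<^sup>2)"
    proof (cases "e \<in> L")
      case False
      then have "\<sigma> e powr s * \<sigma> e powr (- s) \<le> l powr s * \<sigma> e powr (- s)"
        using e s eigenvalue_pos[OF e] by (intro mult_right_mono powr_mono2) (auto simp: L_def)
      then have "1 * (x \<bullet> e)\<^sup>2 \<le> l powr s * \<sigma> e powr (- s) * (x \<bullet> e)\<^sup>2"
        using eigenvalue_pos[OF e] by (intro mult_right_mono) (auto simp flip: powr_add)
      then show ?thesis using w[OF e] False by (simp add: mult.assoc)
    qed (simp add: w[OF e])
  qed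

  have w_scale: "(norm (op_powr S (a / 2) w))\<^sup>2 \<le> l powr (a + s) * W"
  proof (rule has_sum_mono[OF scale_norm has_sum_cmult_right[OF W]])
    fix e assume e: "e \<in> H"
    show "\<sigma> e powr a * (w \<bullet> e)\<^sup>2 \<le> l powr (a + s) * (\<sigma> e powr (- s) * (x \<bullet> e)\<^sup>2)"
    proof (cases "e \<in> L")
      case False
      have "\<sigma> e powr a = \<sigma> e powr (a + s) * \<sigma> e powr (- s)"
        by (simp only: powr_add[symmetric]) simp
      also have "\<dots> \<le> l powr (a + s) * \<sigma> e powr (- s)"
        using False e s a eigenvalue_pos[OF e] by (intro mult_right_mono powr_mono2) (auto simp: L_def)
      finally have "\<sigma> e powr a * (x \<bullet> e)\<^sup>2 \<le> l powr (a + s) * \<sigma> e powr (- s) * (x \<bullet> e)\<^sup>2"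
        by (rule mult_right_mono) simp
      then show ?thesis using w[OF e] False by (simp add: mult.assoc)
    qed (simp add: w[OF e])
  qed

  have below: "(norm (w - r w))\<^sup>2 \<le> (c\<^sup>2 + 1) * c\<^sup>2 * l powr s * W"
  proof -
    \<comment> \<open>By the residual equation the difference \<open>w - r w\<close> lies in the
      range of \<open>S\<close> even if \<open>w\<close> does not, so the energy argument applies to
      it.\<close>
    define z where "z = t *\<^sub>R adjoint A (A (r w))"
    have Sz: "w - r w = S z"
      using r(2)[of w] by (simp add: z_def S.scaleR algebra_simps)
    interpret adjoint_A: bounded_linear "adjoint A" by (rule bounded_linear_adjoint[OF A adjoint_A])
    have "(norm (S z))\<^sup>2 \<le> (c\<^sup>2 + 1) * c\<^sup>2 * l powr (- a) * (norm (op_powr S (a / 2) w))\<^sup>2"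
    proof (rule bias_below_cutoff[OF l tl])
      show "z + t *\<^sub>R adjoint A (A (S z)) = t *\<^sub>R adjoint A (A w)"
        by (simp add: z_def Sz[symmetric, unfolded z_def] A.diff adjoint_A.diff scaleR_diff_right)
    qed
    also have "\<dots> \<le> (c\<^sup>2 + 1) * c\<^sup>2 * l powr (- a) * (l powr (a + s) * W)"
      by (intro mult_left_mono w_scale) auto
    also have "\<dots> = (c\<^sup>2 + 1) * c\<^sup>2 * (l powr (- a) * l powr (a + s)) * W"
      by (simp only: mult_ac)
    also have "\<dots> = (c\<^sup>2 + 1) * c\<^sup>2 * l powr s * W"
      by (simp only: flip: powr_add) simp
    finally show ?thesis by (simp add: Sz)
  qed

  have "r x = r (S g) + w - (w - r w)"
    using linear_add[OF r(1), of "S g" w] by (simp add: w_def)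
  then have "norm (r x) \<le> norm (r (S g)) + norm w + norm (w - r w)"
    by (metis norm_triangle_ineq norm_triangle_ineq4 add_right_mono order_trans)
  then have "(norm (r x))\<^sup>2 \<le> (norm (r (S g)) + norm w + norm (w - r w))\<^sup>2"
    by (rule power_mono) simp
  also have "\<dots> \<le> 3 * ((norm (r (S g)))\<^sup>2 + (norm w)\<^sup>2 + (norm (w - r w))\<^sup>2)"
    using sum_squares_bound[of "norm (r (S g))" "norm w"]
      sum_squares_bound[of "norm (r (S g))" "norm (w - r w)"]
      sum_squares_bound[of "norm w" "norm (w - r w)"]
    by (simp add: power2_eq_square algebra_simps)
  also have "\<dots> \<le> 3 * ((c\<^sup>2 + 1) * c\<^sup>2 * l powr s * W + l powr s * W + (c\<^sup>2 + 1) * c\<^sup>2 * l powr s * W)"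
    by (intro mult_left_mono add_mono above below w_norm) auto
  also have "\<dots> = 3 * (2 * ((c\<^sup>2 + 1) * c\<^sup>2) + 1) * W * l powr s"
    by (simp add: algebra_simps)
  finally show ?thesis by (simp add: ls)
qed

end

section \<open>Algebra of the Kalman recursion\<close>

text \<open>Richardson iteration \<open>x \<mapsto> x - \<tau> (T x - y)\<close> with a small step is a contraction.\<close>

lemma coercive_bij:
  fixes T :: "'y::{real_inner, complete_space} \<Rightarrow> 'y"
  assumes T: "bounded_linear T" and \<delta>: "0 < \<delta>" and coercive: "\<And>x. \<delta> * (norm x)\<^sup>2 \<le> T x \<bullet> x"
  shows "bij T"
proof -
  interpret bounded_linear T by fact
  obtain K where K: "K > 0" "\<And>x. norm (T x) \<le> norm x * K" using pos_bounded by blast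
  \<comment> \<open>The step \<open>\<tau>\<close> below minimises
    \<open>1 - 2 * \<tau> * \<delta> + \<tau>^2 * (K^2 + \<delta>^2)\<close>, and \<open>q\<close>
    is the minimum. Having \<open>K^2 + \<delta>^2\<close> in place of \<open>K^2\<close> gives
    \<open>0 \<le> q\<close> without comparing \<delta> to \<open>K\<close>.\<close>
  define q where "q = 1 - \<delta>\<^sup>2 / (K\<^sup>2 + \<delta>\<^sup>2)"
  have den: "0 < K\<^sup>2 + \<delta>\<^sup>2" using K(1) by (simp add: add_pos_nonneg)
  have q: "0 \<le> q" "q < 1" using den \<delta> by (auto simp: q_def)
  define \<tau> where "\<tau> = \<delta> / (K\<^sup>2 + \<delta>\<^sup>2)"
  have \<tau>: "0 < \<tau>" using den \<delta> by (simp add: \<tau>_def)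
  have contr: "norm (x - \<tau> *\<^sub>R T x) \<le> sqrt q * norm x" for x
  proof -
    have "(norm (T x))\<^sup>2 \<le> (norm x * K)\<^sup>2" by (rule power_mono[OF K(2)]) simp
    also have "\<dots> \<le> (K\<^sup>2 + \<delta>\<^sup>2) * (norm x)\<^sup>2" by (simp add: power_mult_distrib algebra_simps)
    finally have T2: "(norm (T x))\<^sup>2 \<le> (K\<^sup>2 + \<delta>\<^sup>2) * (norm x)\<^sup>2" .
    have "(norm (x - \<tau> *\<^sub>R T x))\<^sup>2 = (norm x)\<^sup>2 - 2 * \<tau> * (T x \<bullet> x) + \<tau>\<^sup>2 * (norm (T x))\<^sup>2"
      unfolding power2_norm_eq_inner
      by (simp add: inner_diff_left inner_diff_right inner_commute[of x "T x"] power2_eq_square algebra_simps)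
    also have "\<dots> \<le> (norm x)\<^sup>2 - 2 * \<tau> * (\<delta> * (norm x)\<^sup>2) + \<tau>\<^sup>2 * ((K\<^sup>2 + \<delta>\<^sup>2) * (norm x)\<^sup>2)"
      using \<tau> by (intro add_mono diff_mono mult_left_mono coercive T2) auto
    also have "\<dots> = (norm x)\<^sup>2 - 2 * \<tau> * (\<delta> * (norm x)\<^sup>2) + \<tau> * ((\<tau> * (K\<^sup>2 + \<delta>\<^sup>2)) * (norm x)\<^sup>2)"
      by (simp only: power2_eq_square mult_ac)
    also have "\<tau> * (K\<^sup>2 + \<delta>\<^sup>2) = \<delta>" using den by (simp add: \<tau>_def)
    also have "(norm x)\<^sup>2 - 2 * \<tau> * (\<delta> * (norm x)\<^sup>2) + \<tau> * (\<delta> * (norm x)\<^sup>2) = q * (norm x)\<^sup>2"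
      by (simp add: q_def \<tau>_def power2_eq_square left_diff_distrib)
    finally have "sqrt ((norm (x - \<tau> *\<^sub>R T x))\<^sup>2) \<le> sqrt (q * (norm x)\<^sup>2)"
      by (rule real_sqrt_le_mono)
    then show ?thesis by (simp add: real_sqrt_mult)
  qed
  have "\<exists>!x. T x = y" for y
  proof -
    have "\<exists>!x. x - \<tau> *\<^sub>R (T x - y) = x"
    proof (rule banach_fix_type[of "sqrt q"])
      show "\<forall>x x'. dist (x - \<tau> *\<^sub>R (T x - y)) (x' - \<tau> *\<^sub>R (T x' - y)) \<le> sqrt q * dist x x'"
      proof (intro allI)
        fix x x'
        have "(x - \<tau> *\<^sub>R (T x - y)) - (x' - \<tau> *\<^sub>R (T x' - y)) = (x - x') - \<tau> *\<^sub>R T (x - x')"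
          by (simp add: diff scaleR_diff_right)
        then show "dist (x - \<tau> *\<^sub>R (T x - y)) (x' - \<tau> *\<^sub>R (T x' - y)) \<le> sqrt q * dist x x'"
          using contr[of "x - x'"] by (simp only: dist_norm)
      qed
    qed (use q in auto)
    moreover have "x - \<tau> *\<^sub>R (T x - y) = x \<longleftrightarrow> T x = y" for x
      using \<tau> by (auto simp: algebra_simps)
    ultimately show ?thesis by simp
  qed
  then show ?thesis unfolding bij_iff by metis
qed

text \<open>Coercivity at \<open>inv T y\<close> bounds the inverse by \<open>1 / \<delta>\<close>.
  This makes the \<open>inv\<close> inside the Kalman gain a true bounded inverse.\<close>

lemma coercive_inv_bounded_linear:
  fixes T :: "'y::{real_inner, complete_space} \<Rightarrow> 'y"
  assumes T: "bounded_linear T" and \<delta>: "0 < \<delta>" and coercive: "\<And>x. \<delta> * (norm x)\<^sup>2 \<le> T x \<bullet> x"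
  shows "bounded_linear (inv T)"
proof -
  interpret bounded_linear T by fact
  have bij: "bij T" by (rule coercive_bij[OF assms])
  have T_inv: "T (inv T y) = y" for y using bij by (simp add: bij_is_surj surj_f_inv_f)
  have inv_T: "inv T (T x) = x" for x using bij by (simp add: bij_is_inj)
  show ?thesis
  proof (rule bounded_linear_intro[of _ "1 / \<delta>"])
    show "inv T (x + y) = inv T x + inv T y" for x y
      by (metis T_inv inv_T add)
    show "inv T (r *\<^sub>R x) = r *\<^sub>R inv T x" for r x
      by (metis T_inv inv_T scaleR)
    show "norm (inv T y) \<le> norm y * (1 / \<delta>)" for y
    proof -
      have "\<delta> * (norm (inv T y))\<^sup>2 \<le> norm y * norm (inv T y)"
        using coercive[of "inv T y"] norm_cauchy_schwarz[of y "inv T y"] by (simp add: T_inv)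
      then have "norm (inv T y) * (\<delta> * norm (inv T y)) \<le> norm (inv T y) * norm y"
        by (simp add: power2_eq_square mult_ac)
      then have "\<delta> * norm (inv T y) \<le> norm y"
        by (cases "inv T y = 0") (auto simp only: mult_le_cancel_left norm_eq_zero zero_less_norm_iff
            norm_zero mult_zero_right norm_ge_zero)
      then show ?thesis using \<delta> by (simp add: field_simps)
    qed
  qed
qed

section \<open>A single step of the filter\<close>

locale kalman_step =
  fixes A :: "'x::real_inner \<Rightarrow> 'y::{real_inner, complete_space}" and \<gamma> :: real and C :: "'x \<Rightarrow> 'x"
  assumes A: "bounded_linear A" and adj: "\<And>x y. A x \<bullet> y = x \<bullet> adjoint A y"
    and \<gamma>: "0 < \<gamma>" and C: "pos_selfadjoint C"
begin

sublocale A: bounded_linear A by (rule A)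
sublocale C: bounded_linear C by (rule pos_selfadjoint_bounded_linear[OF C])

abbreviation "A' \<equiv> adjoint A"

sublocale A': bounded_linear A' by (rule bounded_linear_adjoint[OF A adj])

text \<open>\<open>T\<close> is the covariance of the innovation, coercive because of its noise
  part; \<open>J\<close> is its inverse and \<open>C'\<close> the covariance after the step.\<close>

definition T where "T h = A (C (A' h)) + \<gamma>\<^sup>2 *\<^sub>R h"
definition J where "J = inv T"
definition C' where "C' x = C x - C (A' (J (A (C x))))"

lemma bounded_linear_T: "bounded_linear T"
proof -
  have "bounded_linear (\<lambda>h. A (C (A' h)))"
    using bounded_linear_compose[OF A bounded_linear_compose[OF C.bounded_linear_axioms A'.bounded_linear_axioms]] .
  then show ?thesis
    unfolding T_def by (intro bounded_linear_add bounded_linear_scaleR_right)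
qed

lemma coercive_T: "\<gamma>\<^sup>2 * (norm h)\<^sup>2 \<le> T h \<bullet> h"
  using pos_selfadjoint_nonneg[OF C, of "A' h"]
  by (simp add: T_def inner_add_left adj dot_square_norm)

lemma bounded_linear_J: "bounded_linear J"
  unfolding J_def using coercive_inv_bounded_linear[OF bounded_linear_T _ coercive_T] \<gamma> by simp

lemma T_J: "T (J h) = h"
  unfolding J_def using coercive_bij[OF bounded_linear_T _ coercive_T] \<gamma>
  by (simp add: bij_is_surj surj_f_inv_f)

lemma T_sym: "T h \<bullet> k = h \<bullet> T k"
  by (simp add: T_def inner_add_left inner_add_right adj pos_selfadjoint_sym[OF C])
     (metis adj inner_commute)

lemma J_sym: "J h \<bullet> k = h \<bullet> J k"
  by (metis T_J T_sym)

lemma kalman_gain_eq: "kalman_gain A \<gamma> C y = C (A' (J y))"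
  by (simp add: kalman_gain_def J_def T_def[abs_def])

text \<open>This is \<open>T (J h) = h\<close> at \<open>h = A (C x)\<close>, rearranged. It trades
  the inverse \<open>J\<close> for the updated covariance \<open>C'\<close>.\<close>

lemma A_C': "A (C' x) = \<gamma>\<^sup>2 *\<^sub>R J (A (C x))"
proof -
  have "A (C (A' (J (A (C x))))) + \<gamma>\<^sup>2 *\<^sub>R J (A (C x)) = A (C x)"
    using T_J[of "A (C x)"] unfolding T_def .
  then show ?thesis by (simp add: C'_def A.diff algebra_simps)
qed

text \<open>The gain acts on generalised random elements only through its adjoint. In terms of
  \<open>C'\<close>, the noise of successive steps can be added up.\<close>

lemma adjoint_kalman_gain: "adjoint (kalman_gain A \<gamma> C) = (\<lambda>x. inverse (\<gamma>\<^sup>2) *\<^sub>R A (C' x))"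
proof (rule adjoint_unique, intro allI)
  fix y x
  have "kalman_gain A \<gamma> C y \<bullet> x = y \<bullet> J (A (C x))"
    by (metis C J_sym adj inner_commute kalman_gain_eq pos_selfadjoint_sym)
  then show "kalman_gain A \<gamma> C y \<bullet> x = y \<bullet> inverse (\<gamma>\<^sup>2) *\<^sub>R A (C' x)"
    using \<gamma> by (simp add: A_C')
qed

text \<open>The precision update, in which the inverse covariance grows by
  \<open>A' A / \<gamma>^2\<close>, multiplied out so that no covariance is inverted.\<close>

lemma C_update: "C (x - inverse (\<gamma>\<^sup>2) *\<^sub>R A' (A (C' x))) = C' x"
  using \<gamma> by (simp add: A_C' A'.scaleR C.diff) (simp add: C'_def)

lemma pos_selfadjoint_C': "pos_selfadjoint C'"
  unfolding pos_selfadjoint_def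
proof (intro conjI allI)
  show "bounded_linear C'"
    unfolding C'_def
    by (intro bounded_linear_sub C.bounded_linear_axioms
        bounded_linear_compose[OF C.bounded_linear_axioms] bounded_linear_compose[OF A'.bounded_linear_axioms]
        bounded_linear_compose[OF bounded_linear_J] bounded_linear_compose[OF A])
  show "C' x \<bullet> y = x \<bullet> C' y" for x y
  proof -
    have "C (A' (J (A (C x)))) \<bullet> y = x \<bullet> C (A' (J (A (C y))))"
      by (metis C J_sym adj inner_commute pos_selfadjoint_sym)
    then show ?thesis
      by (simp add: C'_def inner_diff_left inner_diff_right pos_selfadjoint_sym[OF C])
  qed
  show "0 \<le> C' x \<bullet> x" for x
  proof -
    \<comment> \<open>\<open>w\<close> is the adjoint gain applied to \<open>x\<close>, and the
      identity below is Joseph's form of the update: a sum of two nonnegative terms.\<close>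
    define w where "w = J (A (C x))"
    have w: "A (C (A' w)) = A (C x) - \<gamma>\<^sup>2 *\<^sub>R w"
      using T_J[of "A (C x)"] unfolding T_def w_def[symmetric] by (simp add: algebra_simps)
    have 1: "C x \<bullet> A' w = A (C x) \<bullet> w" by (simp add: adj)
    have 2: "C (A' w) \<bullet> x = A (C x) \<bullet> w" by (metis 1 C inner_commute pos_selfadjoint_sym)
    have 3: "C (A' w) \<bullet> A' w = A (C x) \<bullet> w - \<gamma>\<^sup>2 * (w \<bullet> w)"
      by (simp add: adj[symmetric] w inner_diff_left)
    have "C (x - A' w) \<bullet> (x - A' w) + \<gamma>\<^sup>2 * (w \<bullet> w) = C' x \<bullet> x"
      by (simp add: C.diff inner_diff_left inner_diff_right 1 2 3 C'_def flip: w_def)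
    moreover have "0 \<le> C (x - A' w) \<bullet> (x - A' w)" by (rule pos_selfadjoint_nonneg[OF C])
    ultimately show ?thesis by (smt (verit) inner_ge_zero mult_nonneg_nonneg zero_le_power2)
  qed
qed

end

section \<open>The filter over all steps\<close>

locale kalman_filter =
  fixes A :: "'x::real_inner \<Rightarrow> 'y::{real_inner, complete_space}" and S :: "'x \<Rightarrow> 'x" and \<gamma> \<alpha> :: real
  assumes A: "bounded_linear A" and adj: "\<And>x y. A x \<bullet> y = x \<bullet> adjoint A y"
    and S: "pos_selfadjoint S" and \<gamma>: "0 < \<gamma>" and \<alpha>: "0 < \<alpha>"
begin

definition cov where "cov n = kalman_cov A \<gamma> (\<lambda>x. (\<gamma>\<^sup>2 / \<alpha>) *\<^sub>R S x) n"

lemma step_if_pos: "pos_selfadjoint (cov n) \<Longrightarrow> kalman_step A \<gamma> (cov n)"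
  by (intro kalman_step.intro A adj \<gamma>)

text \<open>Conditional on positivity because it is used inside the induction that proves every
  \<open>cov n\<close> positive.\<close>

lemma cov_Suc_if_pos:
  assumes "pos_selfadjoint (cov n)"
  shows "cov (Suc n) = kalman_step.C' A \<gamma> (cov n)"
  using kalman_step.kalman_gain_eq[OF step_if_pos[OF assms]]
    kalman_step.C'_def[OF step_if_pos[OF assms]]
  by (auto simp: cov_def)

lemma cov_pos: "pos_selfadjoint (cov n)"
proof (induction n)
  case 0
  have "bounded_linear (\<lambda>x. (\<gamma>\<^sup>2 / \<alpha>) *\<^sub>R S x)"
    by (intro bounded_linear_scaleR_right bounded_linear_compose[OF bounded_linear_scaleR_right]
        pos_selfadjoint_bounded_linear[OF S])
  moreover have "0 \<le> (\<gamma>\<^sup>2 / \<alpha>) *\<^sub>R S x \<bullet> x" for x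
    using \<alpha> pos_selfadjoint_nonneg[OF S, of x] by simp
  ultimately show ?case
    by (simp add: cov_def pos_selfadjoint_def pos_selfadjoint_sym[OF S])
next
  case (Suc n)
  then show ?case
    by (simp add: cov_Suc_if_pos kalman_step.pos_selfadjoint_C'[OF step_if_pos])
qed

lemmas step = step_if_pos[OF cov_pos]
lemmas cov_Suc = cov_Suc_if_pos[OF cov_pos]

lemma cov_0: "cov 0 x = (\<gamma>\<^sup>2 / \<alpha>) *\<^sub>R S x"
  by (simp add: cov_def)

sublocale A: bounded_linear A by (rule A)
sublocale S: bounded_linear S by (rule pos_selfadjoint_bounded_linear[OF S])
sublocale A': bounded_linear "adjoint A" by (rule bounded_linear_adjoint[OF A adj])

sublocale cov: bounded_linear "cov n" for n by (rule pos_selfadjoint_bounded_linear[OF cov_pos])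

abbreviation "A' \<equiv> adjoint A"

lemma cov_update: "cov n (x - inverse (\<gamma>\<^sup>2) *\<^sub>R A' (A (cov (Suc n) x))) = cov (Suc n) x"
  unfolding cov_Suc by (rule kalman_step.C_update[OF step])

lemma adjoint_gain: "adjoint (kalman_gain A \<gamma> (cov n)) = (\<lambda>x. inverse (\<gamma>\<^sup>2) *\<^sub>R A (cov (Suc n) x))"
  unfolding cov_Suc by (rule kalman_step.adjoint_kalman_gain[OF step])

text \<open>The formula \<open>C\<^sub>n = \<gamma>\<^sup>2 (\<alpha> \<Sigma>\<^sub>0\<^sup>-\<^sup>1 + n A\<^sup>*A)\<^sup>-\<^sup>1\<close>, multiplied out so that no inverse occurs.\<close>

lemma cov_closed_form: "\<alpha> *\<^sub>R cov n x + real n *\<^sub>R S (A' (A (cov n x))) = \<gamma>\<^sup>2 *\<^sub>R S x"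
proof (induction n arbitrary: x)
  case 0
  show ?case using \<alpha> by (simp add: cov_0)
next
  case (Suc n)
  \<comment> \<open>The induction hypothesis is applied to this shifted argument, which
    \<open>cov n\<close> maps to \<open>cov (Suc n) x\<close>; the shift supplies the additional
    copy of \<open>S (A' (A (cov (Suc n) x)))\<close>.\<close>
  have eq: "\<gamma>\<^sup>2 *\<^sub>R S (x - inverse (\<gamma>\<^sup>2) *\<^sub>R A' (A (cov (Suc n) x)))
      = \<gamma>\<^sup>2 *\<^sub>R S x - S (A' (A (cov (Suc n) x)))"
    using \<gamma> by (simp add: S.diff S.scaleR scaleR_diff_right)
  then show ?case
    using Suc.IH[of "x - inverse (\<gamma>\<^sup>2) *\<^sub>R A' (A (cov (Suc n) x))"]
    unfolding cov_update eq by (simp add: algebra_simps)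
qed

definition residual where "residual n x = x - (real n / \<gamma>\<^sup>2) *\<^sub>R cov n (A' (A x))"

lemma linear_residual: "linear (residual n)"
  unfolding residual_def
  by (intro linearI) (simp_all add: A.add A'.add cov.add A.scaleR A'.scaleR cov.scaleR algebra_simps)

text \<open>A rescaled \<open>cov_closed_form\<close> at \<open>A' (A x)\<close>: the equation that
  \<open>bias_bound\<close> requires, with \<open>t = n / \<alpha>\<close>.\<close>

lemma residual_eq:
  "residual n x + (real n / \<alpha>) *\<^sub>R S (A' (A (residual n x))) = x"
proof -
  define y where "y = cov n (A' (A x))"
  have "S (A' (A (residual n x))) = S (A' (A x)) - (real n / \<gamma>\<^sup>2) *\<^sub>R S (A' (A y))"
    by (simp add: residual_def y_def A.diff A'.diff S.diff A.scaleR A'.scaleR S.scaleR)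
  also have "\<dots> = inverse (\<gamma>\<^sup>2) *\<^sub>R (\<gamma>\<^sup>2 *\<^sub>R S (A' (A x)) - real n *\<^sub>R S (A' (A y)))"
    using \<gamma> by (simp add: scaleR_diff_right divide_inverse mult.commute)
  also have "\<dots> = inverse (\<gamma>\<^sup>2) *\<^sub>R (\<alpha> *\<^sub>R y)"
    unfolding cov_closed_form[of n "A' (A x)", symmetric] by (simp add: y_def)
  finally show ?thesis
    using \<alpha> by (simp add: residual_def y_def divide_inverse)
qed

text \<open>The adjoint of \<open>residual n\<close>. The error is seen only through inner products,
  so its recursion runs on the test vectors.\<close>

definition residual_adj where "residual_adj n x = x - (real n / \<gamma>\<^sup>2) *\<^sub>R A' (A (cov n x))"

lemma residual_adj: "residual n x \<bullet> y = x \<bullet> residual_adj n y"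
proof -
  have "cov n (A' (A x)) \<bullet> y = x \<bullet> A' (A (cov n y))"
    by (metis adj cov_pos inner_commute pos_selfadjoint_sym)
  then show ?thesis by (simp add: residual_def residual_adj_def inner_diff_left inner_diff_right)
qed

text \<open>Writing \<open>C\<^sub>n x = (\<gamma>\<^sup>2/\<alpha>) \<Sigma>\<^sub>0 z\<close> turns the claim into \<open>\<langle>\<Sigma>\<^sub>0 z, x\<rangle> \<le> \<langle>\<Sigma>\<^sub>0 z, z\<rangle> + \<langle>\<Sigma>\<^sub>0 x, x\<rangle>/4\<close>.\<close>

lemma noise_gain_bound: "\<gamma>\<^sup>2 * (norm ((real n / \<gamma>\<^sup>2) *\<^sub>R A (cov n x)))\<^sup>2 \<le> real n * \<gamma>\<^sup>2 / \<alpha> * (S x \<bullet> x)"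
proof -
  define k where "k = real n / \<gamma>\<^sup>2"
  define z where "z = residual_adj n x"
  define N where "N = (norm (A (cov n x)))\<^sup>2"
  have k0: "0 \<le> k" by (simp add: k_def)
  have "\<alpha> *\<^sub>R cov n x = \<gamma>\<^sup>2 *\<^sub>R S z"
    using cov_closed_form[of n x] \<gamma>
    by (simp add: z_def residual_adj_def S.diff S.scaleR scaleR_diff_right algebra_simps)
  then have "inverse \<alpha> *\<^sub>R \<alpha> *\<^sub>R cov n x = inverse \<alpha> *\<^sub>R \<gamma>\<^sup>2 *\<^sub>R S z" by simp
  then have cov_z: "cov n x = (\<gamma>\<^sup>2 / \<alpha>) *\<^sub>R S z" using \<alpha> by (simp add: divide_inverse mult.commute)
  \<comment> \<open>Pairing \<open>cov n x\<close> with \<open>z\<close> brings out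
    \<open>k * N\<close>; the formula \<open>cov_z\<close> turns it into a difference of two values
    of the form of \<open>S\<close>.\<close>
  have "cov n x \<bullet> z = cov n x \<bullet> x - k * N"
    by (simp add: z_def residual_adj_def inner_diff_right k_def N_def power2_norm_eq_inner flip: adj)
  then have "k * N = (\<gamma>\<^sup>2 / \<alpha>) * (S z \<bullet> x - S z \<bullet> z)"
    by (simp add: cov_z right_diff_distrib)
  also have "\<dots> \<le> (\<gamma>\<^sup>2 / \<alpha>) * (S x \<bullet> x)"
  proof (intro mult_left_mono)
    have "0 \<le> S (x - 2 *\<^sub>R z) \<bullet> (x - 2 *\<^sub>R z)" by (rule pos_selfadjoint_nonneg[OF S])
    also have "\<dots> = S x \<bullet> x - 4 * (S z \<bullet> x) + 4 * (S z \<bullet> z)"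
      using pos_selfadjoint_sym[OF S, of x z] inner_commute[of x "S z"]
      by (simp add: S.diff S.scaleR inner_diff_left inner_diff_right)
    finally show "S z \<bullet> x - S z \<bullet> z \<le> S x \<bullet> x" using pos_selfadjoint_nonneg[OF S, of x] by linarith
  qed (use \<alpha> in auto)
  finally have "real n * (k * N) \<le> real n * ((\<gamma>\<^sup>2 / \<alpha>) * (S x \<bullet> x))"
    by (rule mult_left_mono) simp
  moreover have "\<gamma>\<^sup>2 * (norm (k *\<^sub>R A (cov n x)))\<^sup>2 = real n * (k * N)"
  proof -
    have "\<gamma>\<^sup>2 * (norm (k *\<^sub>R A (cov n x)))\<^sup>2 = (\<gamma>\<^sup>2 * k) * (k * N)"
      by (simp add: power_mult_distrib N_def) (simp add: power2_eq_square)
    also have "\<gamma>\<^sup>2 * k = real n" using \<gamma> by (simp add: k_def)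
    finally show ?thesis .
  qed
  ultimately show ?thesis by (simp add: k_def)
qed

end

section \<open>Mean square error\<close>

text \<open>Reads unconditional sums as integrals over counting measure, so that Tonelli can
  exchange basis sums and expectations.\<close>

lemma nn_integral_count_space_has_sum:
  fixes f :: "'a \<Rightarrow> real"
  assumes f: "(f has_sum s) B" and nonneg: "\<And>x. x \<in> B \<Longrightarrow> 0 \<le> f x"
  shows "(\<integral>\<^sup>+x. ennreal (f x) \<partial>count_space B) = ennreal s"
proof -
  have "f summable_on B" using f by (rule has_sum_imp_summable)
  then have "(\<lambda>x. norm (f x)) summable_on B"
    by (rule iffD1[OF summable_on_iff_abs_summable_on_real])
  then have abs: "Infinite_Set_Sum.abs_summable_on f B"
    by (rule iffD1[OF abs_summable_equivalent])
  have "(\<integral>\<^sup>+x. ennreal (f x) \<partial>count_space B) = ennreal (infsetsum f B)"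
    by (rule nn_integral_conv_infsetsum[OF abs nonneg])
  also have "infsetsum f B = infsum f B" by (rule infsetsum_infsum[OF abs])
  also have "infsum f B = s" by (rule infsumI[OF f])
  finally show ?thesis .
qed

lemma white_noise_moments:
  fixes \<eta> :: "'y::real_inner \<Rightarrow> 'w \<Rightarrow> real"
  assumes M: "prob_space M" and \<eta>: "white_noise M \<gamma> \<eta>" and \<gamma>: "0 < \<gamma>"
  shows "integrable M (\<lambda>w. (b + \<eta> h w)\<^sup>2)"
    and "(\<integral>w. (b + \<eta> h w)\<^sup>2 \<partial>M) = b\<^sup>2 + \<gamma>\<^sup>2 * (norm h)\<^sup>2"
proof -
  interpret prob_space M by fact
  have "integrable M (\<lambda>w. (b + \<eta> h w)\<^sup>2) \<and> (\<integral>w. (b + \<eta> h w)\<^sup>2 \<partial>M) = b\<^sup>2 + \<gamma>\<^sup>2 * (norm h)\<^sup>2"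
  proof (cases "h = 0")
    case True
    \<comment> \<open>The density clause leaves out \<open>h = 0\<close>. Linearity gives
      \<open>\<eta> 0 = \<eta> 0 + \<eta> 0\<close> almost surely, so \<open>\<eta> 0\<close>
      vanishes almost surely.\<close>
    have "AE w in M. \<eta> (1 *\<^sub>R 0 + 0) w = 1 * \<eta> 0 w + \<eta> 0 w"
      using \<eta> unfolding white_noise_def by blast
    then have ae: "AE w in M. (b + \<eta> h w)\<^sup>2 = b\<^sup>2" by eventually_elim (simp add: True)
    have meas: "(\<lambda>w. (b + \<eta> h w)\<^sup>2) \<in> borel_measurable M"
    proof -
      have [measurable]: "\<eta> h \<in> borel_measurable M" using \<eta> unfolding white_noise_def by blast
      show ?thesis by measurable
    qed
    show ?thesis
      using integrable_cong_AE[OF meas _ ae] integral_cong_AE[OF meas _ ae] True by (simp add: prob_space)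
  next
    case False
    define \<sigma> where "\<sigma> = \<gamma> * norm h"
    have \<sigma>: "0 < \<sigma>" using False \<gamma> by (simp add: \<sigma>_def)
    have D: "distributed M lborel (\<eta> h) (normal_density 0 \<sigma>)"
      using \<eta> False unfolding white_noise_def \<sigma>_def by blast
    have int1: "integrable M (\<eta> h)"
      using distributed_integrable[OF D, of "\<lambda>x. x"] integrable_normal_moment_nz_1[OF \<sigma>, of 0] by simp
    have int2: "integrable M (\<lambda>w. (\<eta> h w)\<^sup>2)"
      using distributed_integrable[OF D, of "\<lambda>x. x\<^sup>2"] integrable_normal_moment[OF \<sigma>, of 0 2] by simp
    have mean: "expectation (\<eta> h) = 0" by (rule normal_distributed_expectation[OF \<sigma> D])
    have var: "expectation (\<lambda>w. (\<eta> h w)\<^sup>2) = \<sigma>\<^sup>2"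
      using normal_distributed_variance[OF \<sigma> D] mean by simp
    have expand: "(b + \<eta> h w)\<^sup>2 = b\<^sup>2 + (2 * b) * \<eta> h w + (\<eta> h w)\<^sup>2" for w
      by (simp add: power2_sum)
    show ?thesis
      unfolding expand using int1 int2
      by (simp add: mean var prob_space \<sigma>_def power_mult_distrib)
  qed
  then show "integrable M (\<lambda>w. (b + \<eta> h w)\<^sup>2)"
    and "(\<integral>w. (b + \<eta> h w)\<^sup>2 \<partial>M) = b\<^sup>2 + \<gamma>\<^sup>2 * (norm h)\<^sup>2" by blast+
qed

section \<open>Error of the mean as bias plus noise\<close>

context kalman_filter
begin

text \<open>Induction over all test vectors: one step replaces \<open>x\<close> by some
  \<open>y\<close> with \<open>cov n y = cov (Suc n) x\<close>. All steps share one draw, so the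
  noise coefficient \<open>n / \<gamma>^2\<close> grows by \<open>1 / \<gamma>^2\<close>. The null
  set may depend on \<open>x\<close>.\<close>

lemma mean_error:
  fixes \<eta> :: "'y \<Rightarrow> 'w \<Rightarrow> real"
  assumes \<eta>: "white_noise M \<gamma> \<eta>"
    and m: "kalman_mean M A \<gamma> (\<lambda>x. (\<gamma>\<^sup>2 / \<alpha>) *\<^sub>R S x) m\<^sub>0 (data_model_2 A u \<eta>) m"
  shows "AE w in M. (m n w - u) \<bullet> x = residual n (m\<^sub>0 - u) \<bullet> x + \<eta> ((real n / \<gamma>\<^sup>2) *\<^sub>R A (cov n x)) w"
proof -
  have lin: "AE w in M. \<eta> (r *\<^sub>R h + k) w = r * \<eta> h w + \<eta> k w" for r h k
    using \<eta> unfolding white_noise_def by blast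
  have "AE w in M. (m n w - u) \<bullet> x = (m\<^sub>0 - u) \<bullet> residual_adj n x + \<eta> ((real n / \<gamma>\<^sup>2) *\<^sub>R A (cov n x)) w"
  proof (induction n arbitrary: x)
    case 0
    have "AE w in M. m 0 w = m\<^sub>0" using m by (intro AE_I2) (simp add: kalman_mean_def)
    with lin[of 1 0 0] show ?case
      by eventually_elim (simp add: residual_adj_def)
  next
    case (Suc n)
    define k where "k = inverse (\<gamma>\<^sup>2) *\<^sub>R A (cov (Suc n) x)"
    define y where "y = x - A' k"
    obtain Z where Z: "is_image_of M (kalman_gain A \<gamma> (cov n))
        (\<lambda>h w. data_model_2 A u \<eta> (Suc n) h w - A (m n w) \<bullet> h) Z"
      and mZ: "\<forall>w\<in>space M. m (Suc n) w = m n w + Z w"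
      using m unfolding kalman_mean_def cov_def by blast
    have "AE w in M. Z w \<bullet> x = A u \<bullet> k + \<eta> k w - A (m n w) \<bullet> k"
      using Z unfolding is_image_of_def adjoint_gain data_model_2_def k_def by blast
    moreover have "AE w in M. m (Suc n) w = m n w + Z w" using mZ by (intro AE_I2) blast
    moreover have "cov n y = cov (Suc n) x"
      using cov_update[of n x] by (simp add: y_def k_def A'.scaleR)
    then have "AE w in M. (m n w - u) \<bullet> y
        = (m\<^sub>0 - u) \<bullet> residual_adj n y + \<eta> ((real n / \<gamma>\<^sup>2) *\<^sub>R A (cov (Suc n) x)) w"
      using Suc.IH[of y] by simp
    moreover have "(real n / \<gamma>\<^sup>2) *\<^sub>R A (cov (Suc n) x) + 1 *\<^sub>R k = (real (Suc n) / \<gamma>\<^sup>2) *\<^sub>R A (cov (Suc n) x)"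
      by (simp add: k_def divide_inverse algebra_simps)
    then have "AE w in M. \<eta> ((real (Suc n) / \<gamma>\<^sup>2) *\<^sub>R A (cov (Suc n) x)) w
        = \<eta> k w + \<eta> ((real n / \<gamma>\<^sup>2) *\<^sub>R A (cov (Suc n) x)) w"
      using lin[of 1 k "(real n / \<gamma>\<^sup>2) *\<^sub>R A (cov (Suc n) x)"] by (simp add: add.commute)
    ultimately show ?case
    proof eventually_elim
      case (elim w)
      have "residual_adj n y = residual_adj (Suc n) x"
        using \<open>cov n y = cov (Suc n) x\<close>
        by (simp add: residual_adj_def y_def k_def A'.scaleR divide_inverse algebra_simps)
      moreover have "(m n w - u) \<bullet> y = (m n w - u) \<bullet> x - A (m n w) \<bullet> k + A u \<bullet> k"
        by (simp add: y_def inner_diff_left inner_diff_right adj)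
      ultimately show ?case using elim by (simp add: inner_diff_left inner_add_left)
    qed
  qed
  then show ?thesis by (simp add: residual_adj)
qed

end

text \<open>Measurability is followed coordinatewise, as a sum of Borel maps into a nonseparable
  space may fail to be Borel.\<close>

lemma kalman_mean_inner_measurable:
  assumes "kalman_mean M A \<gamma> C\<^sub>0 m\<^sub>0 y m"
  shows "(\<lambda>w. m n w \<bullet> x) \<in> borel_measurable M"
proof (induction n)
  case 0
  have "(\<lambda>w. m\<^sub>0 \<bullet> x) \<in> borel_measurable M" by simp
  then show ?case
    by (rule measurable_cong[THEN iffD1, rotated]) (use assms in \<open>simp add: kalman_mean_def\<close>)
next
  case (Suc n)
  obtain Z where Z: "Z \<in> borel_measurable M" and mZ: "\<forall>w\<in>space M. m (Suc n) w = m n w + Z w"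
    using assms unfolding kalman_mean_def is_image_of_def by metis
  have "(\<lambda>w. Z w \<bullet> x) \<in> borel_measurable M"
    by (rule borel_measurable_continuous_on[OF _ Z, of "\<lambda>z. z \<bullet> x"]) (intro continuous_intros)
  with Suc have "(\<lambda>w. m n w \<bullet> x + Z w \<bullet> x) \<in> borel_measurable M" by simp
  then show ?case
    by (rule measurable_cong[THEN iffD1, rotated]) (use mZ in \<open>simp add: inner_add_left\<close>)
qed

text \<open>A summable real family has countable support, and here every term is positive.\<close>

lemma countable_orthonormal_if_trace_class:
  fixes S :: "'x::{real_inner, complete_space} \<Rightarrow> 'x" and B :: "'x set"
  assumes S: "pos_selfadjoint S" and tr: "pos_trace_class S" and B: "orthonormal B"
    and pos: "\<And>x. x \<noteq> 0 \<Longrightarrow> 0 < S x \<bullet> x"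
  shows "countable B"
proof -
  have "countable {e \<in> B. S e \<bullet> e \<noteq> 0}"
    by (rule summable_countable_real[OF trace_class_summable[OF S tr B]])
  moreover have "{e \<in> B. S e \<bullet> e \<noteq> 0} = B"
  proof -
    have "S e \<bullet> e \<noteq> 0" if "e \<in> B" for e
      using that B pos[of e] by (force simp: orthonormal_def)
    then show ?thesis by blast
  qed
  ultimately show ?thesis by simp
qed

text \<open>Parseval writes the squared norm as a countable sum of squared coordinates. This makes
  it measurable, and Tonelli then bounds its expectation coordinate by coordinate.\<close>

lemma second_moment_le:
  fixes X :: "'w \<Rightarrow> 'x::{real_inner, complete_space}"
  assumes B: "orthonormal_basis B" "countable B"
    and meas: "\<And>e. e \<in> B \<Longrightarrow> (\<lambda>w. X w \<bullet> e) \<in> borel_measurable M"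
    and int: "\<And>e. e \<in> B \<Longrightarrow> (\<integral>\<^sup>+w. ennreal ((X w \<bullet> e)\<^sup>2) \<partial>M) \<le> ennreal (f e)"
    and f: "(f has_sum s) B" "\<And>e. e \<in> B \<Longrightarrow> 0 \<le> f e"
  shows "integrable M (\<lambda>w. (norm (X w))\<^sup>2) \<and> (\<integral>w. (norm (X w))\<^sup>2 \<partial>M) \<le> s"
proof -
  have s: "0 \<le> s" by (rule has_sum_nonneg[OF f])
  have eq: "ennreal ((norm (X w))\<^sup>2) = (\<integral>\<^sup>+e. ennreal ((X w \<bullet> e)\<^sup>2) \<partial>count_space B)" for w
    by (rule nn_integral_count_space_has_sum[symmetric, OF parseval[OF B(1)]]) simp
  have meas2: "(\<lambda>w. ennreal ((X w \<bullet> e)\<^sup>2)) \<in> borel_measurable M" if "e \<in> B" for e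
    using meas[OF that] by measurable
  have "(\<lambda>w. \<integral>\<^sup>+e. ennreal ((X w \<bullet> e)\<^sup>2) \<partial>count_space B) \<in> borel_measurable M"
  proof (rule sigma_finite_measure.borel_measurable_nn_integral)
    show "sigma_finite_measure (count_space B)" by (rule sigma_finite_measure_count_space_countable[OF B(2)])
    have "(\<lambda>(e, w). ennreal ((X w \<bullet> e)\<^sup>2)) \<in> borel_measurable (count_space B \<Otimes>\<^sub>M M)"
      by (rule measurable_pair_measure_countable1[OF B(2)]) (use meas2 in simp)
    then show "(\<lambda>(w, e). ennreal ((X w \<bullet> e)\<^sup>2)) \<in> borel_measurable (M \<Otimes>\<^sub>M count_space B)"
      by (rule measurable_pair_swap[of "\<lambda>(e, w). ennreal ((X w \<bullet> e)\<^sup>2)", simplified])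
  qed
  then have "(\<lambda>w. enn2real (ennreal ((norm (X w))\<^sup>2))) \<in> borel_measurable M"
    unfolding eq by measurable
  then have measX: "(\<lambda>w. (norm (X w))\<^sup>2) \<in> borel_measurable M" by simp
  have "(\<integral>\<^sup>+w. ennreal ((norm (X w))\<^sup>2) \<partial>M)
      = (\<integral>\<^sup>+e. \<integral>\<^sup>+w. ennreal ((X w \<bullet> e)\<^sup>2) \<partial>M \<partial>count_space B)"
    unfolding eq by (rule nn_integral_count_space_nn_integral[OF B(2) meas2])
  also have "\<dots> \<le> (\<integral>\<^sup>+e. ennreal (f e) \<partial>count_space B)"
    using int by (intro nn_integral_mono) simp
  also have "\<dots> = ennreal s" by (rule nn_integral_count_space_has_sum[OF f])
  finally have le: "(\<integral>\<^sup>+w. ennreal ((norm (X w))\<^sup>2) \<partial>M) \<le> ennreal s" .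
  have "integrable M (\<lambda>w. (norm (X w))\<^sup>2)"
    by (rule integrableI_nonneg[OF measX]) (use le in \<open>auto intro: le_less_trans\<close>)
  moreover have "(\<integral>w. (norm (X w))\<^sup>2 \<partial>M) \<le> s" by (rule integral_real_bounded[OF s le])
  ultimately show ?thesis by blast
qed

lemma kalman_mean_square_error:
  fixes A :: "'x::{real_inner, complete_space} \<Rightarrow> 'y::{real_inner, complete_space}"
    and m :: "nat \<Rightarrow> 'w \<Rightarrow> 'x"
  assumes filter: "kalman_filter A S \<gamma> \<alpha>" and tr: "pos_trace_class S"
    and pos: "\<And>x. x \<noteq> 0 \<Longrightarrow> 0 < S x \<bullet> x"
    and M: "prob_space M" and \<eta>: "white_noise M \<gamma> \<eta>"
    and m: "kalman_mean M A \<gamma> (\<lambda>x. (\<gamma>\<^sup>2 / \<alpha>) *\<^sub>R S x) m\<^sub>0 (data_model_2 A u \<eta>) m"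
  shows "integrable M (\<lambda>w. (norm (m n w - u))\<^sup>2) \<and>
    (\<integral>w. (norm (m n w - u))\<^sup>2 \<partial>M)
      \<le> (norm (kalman_filter.residual A S \<gamma> \<alpha> n (m\<^sub>0 - u)))\<^sup>2 + real n * \<gamma>\<^sup>2 / \<alpha> * op_trace S"
proof -
  interpret kalman_filter A S \<gamma> \<alpha> by fact
  \<comment> \<open>The basis that \<open>op_trace\<close> selects, so the variance bounds sum to a
    multiple of \<open>op_trace S\<close> itself.\<close>
  define B :: "'x set" where "B = (SOME E. orthonormal_basis E)"
  have B: "orthonormal_basis B"
    unfolding B_def by (rule someI[of orthonormal_basis]) (rule orthonormal_basis_eigenbasis[OF S tr])
  then have on: "orthonormal B" by (simp add: orthonormal_basis_iff)
  have "((\<lambda>e. S e \<bullet> e) has_sum op_trace S) B"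
    unfolding op_trace_def B_def[symmetric] using trace_class_summable[OF S tr on] by simp
  then have sum: "((\<lambda>e. (residual n (m\<^sub>0 - u) \<bullet> e)\<^sup>2 + real n * \<gamma>\<^sup>2 / \<alpha> * (S e \<bullet> e)) has_sum
      (norm (residual n (m\<^sub>0 - u)))\<^sup>2 + real n * \<gamma>\<^sup>2 / \<alpha> * op_trace S) B"
    by (intro has_sum_add has_sum_cmult_right parseval[OF B])
  show ?thesis
  proof (rule second_moment_le[OF B countable_orthonormal_if_trace_class[OF S tr on pos] _ _ sum])
    fix e assume "e \<in> B"
    show meas: "(\<lambda>w. (m n w - u) \<bullet> e) \<in> borel_measurable M"
      using kalman_mean_inner_measurable[OF m, of n e] by (simp add: inner_diff_left)
    let ?h = "(real n / \<gamma>\<^sup>2) *\<^sub>R A (cov n e)" and ?b = "residual n (m\<^sub>0 - u) \<bullet> e"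
    have "(\<integral>\<^sup>+w. ennreal (((m n w - u) \<bullet> e)\<^sup>2) \<partial>M) = (\<integral>\<^sup>+w. ennreal ((?b + \<eta> ?h w)\<^sup>2) \<partial>M)"
      by (rule nn_integral_cong_AE) (use mean_error[OF \<eta> m, of n e] in \<open>eventually_elim, simp\<close>)
    also have "\<dots> = ennreal (?b\<^sup>2 + \<gamma>\<^sup>2 * (norm ?h)\<^sup>2)"
      using nn_integral_eq_integral[OF white_noise_moments(1)[OF M \<eta> \<gamma>], of ?b ?h]
      by (simp add: white_noise_moments(2)[OF M \<eta> \<gamma>])
    also have "\<dots> \<le> ennreal (?b\<^sup>2 + real n * \<gamma>\<^sup>2 / \<alpha> * (S e \<bullet> e))"
      by (intro ennreal_leI add_left_mono noise_gain_bound)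
    finally show "(\<integral>\<^sup>+w. ennreal (((m n w - u) \<bullet> e)\<^sup>2) \<partial>M) \<le> \<dots>" .
    show "0 \<le> ?b\<^sup>2 + real n * \<gamma>\<^sup>2 / \<alpha> * (S e \<bullet> e)"
      using pos_selfadjoint_nonneg[OF S, of e] \<alpha> by simp
  qed
qed

theorem theorem3:
  fixes A :: "'x::{real_inner, complete_space} \<Rightarrow> 'y::{real_inner, complete_space}"
    and \<Sigma>\<^sub>0 :: "'x \<Rightarrow> 'x" and u m\<^sub>0 :: 'x and a c s :: real
  assumes "compact_operator A"
    and "assumption_A A \<Sigma>\<^sub>0 u m\<^sub>0 a c s"
  shows "\<exists>C::real. 0 \<le> C \<and>
    (\<forall>(M::'w measure) \<gamma> \<alpha> \<eta> m.
       prob_space M \<and> 0 < \<gamma> \<and> 0 < \<alpha> \<and> white_noise M \<gamma> \<eta> \<and>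
       kalman_mean M A \<gamma> (\<lambda>x. (\<gamma>\<^sup>2 / \<alpha>) *\<^sub>R \<Sigma>\<^sub>0 x) m\<^sub>0 (data_model_2 A u \<eta>) m \<longrightarrow>
       (\<forall>n\<ge>1. integrable M (\<lambda>w. (norm (m n w - u))\<^sup>2) \<and>
          integral\<^sup>L M (\<lambda>w. (norm (m n w - u))\<^sup>2)
            \<le> C * (\<alpha> / real n) powr (s / (a + 1)) + real n * \<gamma>\<^sup>2 / \<alpha> * op_trace \<Sigma>\<^sub>0)) \<and>
    (\<forall>(M::'w measure) \<gamma> \<alpha> \<eta> m N.
       prob_space M \<and> 1 \<le> N \<and> \<alpha> = 1 \<and> 0 < \<gamma> \<and>
       \<gamma>\<^sup>2 = real N powr (- ((a + s + 1) / (a + 1))) \<and> white_noise M \<gamma> \<eta> \<and>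
       kalman_mean M A \<gamma> (\<lambda>x. (\<gamma>\<^sup>2 / \<alpha>) *\<^sub>R \<Sigma>\<^sub>0 x) m\<^sub>0 (data_model_2 A u \<eta>) m \<longrightarrow>
       integrable M (\<lambda>w. (norm (m N w - u))\<^sup>2) \<and>
       integral\<^sup>L M (\<lambda>w. (norm (m N w - u))\<^sup>2)
         \<le> (C + op_trace \<Sigma>\<^sub>0) * real N powr (- (s / (a + 1))))"
proof -
  have S: "pos_selfadjoint \<Sigma>\<^sub>0" and inj: "inj \<Sigma>\<^sub>0" and tr: "pos_trace_class \<Sigma>\<^sub>0"
    and a: "0 < a" and c: "1 \<le> c" and s: "0 \<le> s" "s \<le> a + 2"
    and link: "\<And>x. inverse c * norm (op_powr \<Sigma>\<^sub>0 (a / 2) x) \<le> norm (A x)"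
      "\<And>x. norm (A x) \<le> c * norm (op_powr \<Sigma>\<^sub>0 (a / 2) x)"
    and dom: "m\<^sub>0 - u \<in> op_powr_dom \<Sigma>\<^sub>0 (- s / 2)"
    using assms(2) by (auto simp: assumption_A_def)
  have A: "bounded_linear A"
  proof -
    have lin: "linear A" and "compact (closure (A ` cball 0 1))"
      using assms(1) by (auto simp: compact_operator_def)
    then have "bounded (A ` cball 0 1)"
      by (meson bounded_subset closure_subset compact_imp_bounded)
    then obtain K where K: "norm (A x) \<le> K" if "norm x \<le> 1" for x
      unfolding bounded_iff by (metis imageI mem_cball_0)
    have "norm (A x) \<le> norm x * K" for x
    proof (cases "x = 0")
      case False
      then have "norm (A (inverse (norm x) *\<^sub>R x)) \<le> K" by (intro K) simp
      then show ?thesis using False by (simp add: linear_scale[OF lin] field_simps)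
    qed (simp add: linear_0[OF lin])
    then show ?thesis by (intro bounded_linear_intro linear_add[OF lin] linear_scale[OF lin])
  qed
  interpret hilbert_scale_link A \<Sigma>\<^sub>0 a c
    by (intro hilbert_scale_link.intro A S inj tr a c link)
  \<comment> \<open>The squared norm of \<open>m\<^sub>0 - u\<close> under the power
    \<open>-s/2\<close> of the prior covariance. It does not involve \<open>n\<close>, \<gamma> or
    \<alpha>, so neither does the constant built from it.\<close>
  define W where "W = (\<Sum>\<^sub>\<infinity>e\<in>eigenbasis \<Sigma>\<^sub>0. (\<Sigma>\<^sub>0 e \<bullet> e) powr (- s) * ((m\<^sub>0 - u) \<bullet> e)\<^sup>2)"
  have W: "((\<lambda>e. (\<Sigma>\<^sub>0 e \<bullet> e) powr (- s) * ((m\<^sub>0 - u) \<bullet> e)\<^sup>2) has_sum W) (eigenbasis \<Sigma>\<^sub>0)"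
    using dom unfolding W_def op_powr_dom_def by (simp add: powr_mult_square)
  have W0: "0 \<le> W" by (rule has_sum_nonneg[OF W]) simp
  define C where "C = 3 * (2 * ((c\<^sup>2 + 1) * c\<^sup>2) + 1) * W"
  have C0: "0 \<le> C" using W0 by (simp add: C_def)
  have bound: "integrable M (\<lambda>w. (norm (m n w - u))\<^sup>2) \<and>
      (\<integral>w. (norm (m n w - u))\<^sup>2 \<partial>M)
        \<le> C * (\<alpha> / real n) powr (s / (a + 1)) + real n * \<gamma>\<^sup>2 / \<alpha> * op_trace \<Sigma>\<^sub>0"
    if M: "prob_space M" and \<gamma>: "0 < \<gamma>" and \<alpha>: "0 < \<alpha>" and \<eta>: "white_noise M \<gamma> \<eta>"
      and m: "kalman_mean M A \<gamma> (\<lambda>x. (\<gamma>\<^sup>2 / \<alpha>) *\<^sub>R \<Sigma>\<^sub>0 x) m\<^sub>0 (data_model_2 A u \<eta>) m" and n: "1 \<le> n"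
    for M :: "'w measure" and \<gamma> \<alpha> \<eta> m n
  proof -
    interpret filter: kalman_filter A \<Sigma>\<^sub>0 \<gamma> \<alpha>
      by (intro kalman_filter.intro A S \<gamma> \<alpha> adjoint_A)
    have "(norm (filter.residual n (m\<^sub>0 - u)))\<^sup>2 \<le> C * (real n / \<alpha>) powr (- (s / (a + 1)))"
      unfolding C_def
      by (rule bias_bound[OF _ filter.linear_residual filter.residual_eq s W]) (use n \<alpha> in simp)
    also have "(real n / \<alpha>) powr (- (s / (a + 1))) = (\<alpha> / real n) powr (s / (a + 1))"
      using n \<alpha> by (simp add: powr_minus powr_divide)
    finally show ?thesis
      using kalman_mean_square_error[OF filter.kalman_filter_axioms tr form_pos M \<eta> m, of n] by linarith
  qed
  \<comment> \<open>The prescribed noise level makes \<open>N * \<gamma>^2\<close> decay exactly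
    like the bias bound.\<close>
  have rate: "real N * real N powr (- ((a + s + 1) / (a + 1))) = real N powr (- (s / (a + 1)))"
    if "1 \<le> N" for N :: nat
  proof -
    have "1 + - ((a + s + 1) / (a + 1)) = - (s / (a + 1))" using a by (simp add: field_simps)
    then show ?thesis using that powr_add[of "real N" 1 "- ((a + s + 1) / (a + 1))"] by simp
  qed
  show ?thesis
  proof (intro exI[of _ C] conjI[OF C0] conjI allI impI, goal_cases)
    case (1 M \<gamma> \<alpha> \<eta> m n)
    then show ?case using bound[of M \<gamma> \<alpha> \<eta> m n] by blast
  next
    case (2 M \<gamma> \<alpha> \<eta> m n)
    then show ?case using bound[of M \<gamma> \<alpha> \<eta> m n] by blast
  next
    case (3 M \<gamma> \<alpha> \<eta> m N)
    then have "0 < \<alpha>" by simp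
    with 3 show ?case using bound[of M \<gamma> \<alpha> \<eta> m N] by blast
  next
    case (4 M \<gamma> \<alpha> \<eta> m N)
    then have \<alpha>: "\<alpha> = 1" and "0 < \<alpha>" by simp_all
    have "(\<integral>w. (norm (m N w - u))\<^sup>2 \<partial>M)
        \<le> C * (\<alpha> / real N) powr (s / (a + 1)) + real N * \<gamma>\<^sup>2 / \<alpha> * op_trace \<Sigma>\<^sub>0"
      using 4 bound[of M \<gamma> \<alpha> \<eta> m N] \<open>0 < \<alpha>\<close> by blast
    also have "(\<alpha> / real N) powr (s / (a + 1)) = real N powr (- (s / (a + 1)))"
      by (simp add: \<alpha> powr_minus_divide powr_divide)
    also have "real N * \<gamma>\<^sup>2 / \<alpha> = real N powr (- (s / (a + 1)))"
      using 4 rate[of N] by simp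
    finally show ?case by (simp add: distrib_right mult.commute)
  qed
qed

end
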